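(* Let $G$ be a hierarchically hyperbolic group with its coarse median structure $[\mu]$, and let $\kappa$ be a sublinear function. The canonical (identity) bijection $$(\partial_\kappa G,\mathcal T_{med})\longrightarrow(\partial_\kappa G,\mathcal T(G,[\mathcal C(S)]))$$ is a homeomorphism.
   Context: **$\kappa$-Morse boundary.** $\kappa:[0,\infty)\to[0,\infty)$ is monotone increasing (constants allowed), concave, with $\lim_{t\to\infty}\kappa(t)/t=0$. A $(K,C)$-quasi-geodesic is a map from an interval with $\frac1K|s-t|-C\le d(\gamma(s),\gamma(t))\le K|s-t|+C$. With basepoint $o$, $\kappa(y):=\kappa(d(o,y))$, $\mathcal N_\kappa(Z,n)=\{y:d(y,Z)\le n\kappa(y)\}$. Quasi-geodesic rays $\kappa$-fellow travel (are $\kappa$-close) if each lies in some $\mathcal N_\kappa(\cdot,n)$ of the other. $Z$ is $\kappa$-Morse if there is $\mu_Z:\mathbb R_+^2\to\mathbb R_+$ such that every $(K,C)$-quasi-geodesic segment with endpoints on $Z$ lies in $\mathcal N_\kappa(Z,\mu_Z(K,C))$. $\partial_\kappa Y$ is the set of $\kappa$-Morse quasi-geodesic rays modulo $\kappa$-fellow travelling; $\partial_\kappa G$ is $\partial_\kappa$ of $G$ with a word metric $d_G$ (Cayley graph). **Coarse medians.** A coarse median on a metric space $Y$ is a map $\mu:Y^3\to Y$ with a constant $C$ such that $\mu(a,a,b)=a$; $\mu$ is symmetric; $d(\mu(\mu(a,x,b),x,c),\mu(a,x,\mu(b,x,c)))\le C$; $d(\mu(a,b,c),\mu(x,b,c))\le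 Cd(a,x)+C$. A coarse median structure $[\mu]$ is a class modulo bounded distance. An interval in $\mathbb R$ has the standard median (middle point). A $D$-median ray is a $(D,D)$-quasi-geodesic ray $h:[0,\infty)\to Y$ with $d(h(\mathrm{med}(a,b,c)),\mu(h(a),h(b),h(c)))\le D$ for all $a,b,c$. **Hyperbolicity and boundaries.** $(x\mid y)_o=\frac12(d(o,x)+d(o,y)-d(x,y))$; $X$ is $\delta$-hyperbolic if $(x\mid y)_o\ge\min\{(x\mid z)_o,(z\mid y)_o\}-\delta$ always. Sequences converge to infinity if $(x_i\mid x_j)_o\to\infty$, are equivalent if $(x_i\mid y_i)_o\to\infty$; $\partial_\infty X$ is the set of classes, with $(\xi\mid\eta)_o=\inf\liminf(x_i\mid y_i)_o$ and visual topology given by neighbourhood bases $\{\eta:(\xi\mid\eta)_o>R\}$. A map $\gamma:[a,\infty)\to X$ defines $\xi$ if for all increasing $t_i\to\infty$, $(\gamma(t_i))$ converges to infinity and represents $\xi$. **Hierarchically hyperbolic groups (Behrstock–Hagen–Sisto).** A quasi-geodesic space $(\mathcal X,d)$ is a hierarchically hyperbolic space if there are constants $\delta,\xi_0,K,\kappa_0,n,\lambda,E,\alpha$, an index set $\mathfrak S$, and $\delta$-hyperbolic geodesic spaces $\mathcal C(W)$, $W\in\mathfrak S$, such that (writing $d_W$ for distance in $\mathcal C(W)$, also between projections of points): (1) there are $(K,K)$-coarsely Lipschitz maps $\pi_W:\mathcal X\to2^{\mathcal C(W)}$ with nonempty values of diameter $\le\xi_0$ and $K$-quasiconvex image; (2)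 $\mathfrak S$ has a partial order $\sqsubseteq$ (nesting) with a unique maximal element $S$; write $\mathfrak S_W=\{V:V\sqsubseteq W\}$; if $V\sqsubsetneq W$ there are a specified nonempty $\rho^V_W\subset\mathcal C(W)$ of diameter $\le\xi_0$ and a map $\rho^W_V:\mathcal C(W)\to2^{\mathcal C(V)}$; (3) there is a symmetric anti-reflexive relation $\perp$; $V\sqsubseteq W\perp U$ implies $V\perp U$; for $T\in\mathfrak S$ and $U\in\mathfrak S_T$ with $\{V\in\mathfrak S_T:V\perp U\}\ne\emptyset$ there is $W\in\mathfrak S_T\setminus\{T\}$ such that $V\sqsubseteq W$ whenever $V\perp U$, $V\sqsubseteq T$; orthogonal elements are not $\sqsubseteq$-comparable; (4) $V,W$ are transverse ($V\pitchfork W$) if neither orthogonal nor comparable; then there are sets $\rho^V_W\subset\mathcal C(W)$, $\rho^W_V\subset\mathcal C(V)$ of diameter $\le\xi_0$ with $\min\{d_W(\pi_W(x),\rho^V_W),d_V(\pi_V(x),\rho^W_V)\}\le\kappa_0$ for all $x$; if $V\sqsubsetneq W$, $\min\{d_W(\pi_W(x),\rho^V_W),\mathrm{diam}(\pi_V(x)\cup\rho^W_V(\pi_W(x)))\}\le\kappa_0$; if $U\sqsubseteq V$ then $d_W(\rho^U_W,\rho^V_W)\le\kappa_0$ whenever $V\sqsubsetneq W$, or $V\pitchfork W$ and $W\not\perp U$; (5) sets of pairwise comparable elements have cardinality $\le n$; (6) for $W\in\mathfrak S$, $x,x'\in\mathcal X$ and $N=\lambda d_W(x,x')+\lambda$ there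 are $T_1,\dots,T_{\lfloor N\rfloor}\in\mathfrak S_W\setminus\{W\}$ such that each $T\in\mathfrak S_W\setminus\{W\}$ either is nested in some $T_i$ or satisfies $d_T(x,x')<E$; and $d_W(\pi_W(x),\rho^{T_i}_W)\le N$ for all $i$; (7) for $V\sqsubsetneq W$ and every geodesic $\gamma$ of $\mathcal C(W)$, either $\mathrm{diam}(\rho^W_V(\gamma))\le E$ or $\gamma$ meets the $E$-neighbourhood of $\rho^V_W$; (8) for pairwise orthogonal $\{V_j\}$ and $p_j\in\pi_{V_j}(\mathcal X)$ there is $x$ with $d_{V_j}(x,p_j)\le\alpha$ for all $j$, and $d_V(x,\rho^{V_j}_V)\le\alpha$ whenever $V_j\sqsubsetneq V$ or $V\pitchfork V_j$; (9) for each $k\ge0$ there is $\theta(k)$ such that $d(x,y)\ge\theta(k)$ implies $d_V(x,y)\ge k$ for some $V$. A finitely generated group $G$ is hierarchically hyperbolic if $(G,d_G)$ has such a structure, $G$ acts on $\mathfrak S$ with finitely many orbits preserving $\sqsubseteq,\perp,\pitchfork$, and there are isometries $g:\mathcal C(W)\to\mathcal C(gW)$, compatible with composition, with $g\pi_W(x)=\pi_{gW}(gx)$ and $g\rho^V_W=\rho^{gV}_{gW}$ (up to uniformly bounded error). **Coarse median of $G$.** $[\mu]$ is the class of maps $\mu:G^3\to G$ such that, uniformly in $x,y,z\in G$ and $W\in\mathfrak S$, $\pi_W(\mu(x,y,z))$ is at bounded distance from the coarse centre of a geodesic triangle in $\mathcal C(W)$ with vertices in $\pi_W(x),\pi_W(y),\pi_W(z)$.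 **The space $\mathcal C(S)$.** An isometric action of $G$ on $X$ is acylindrical if for every $\epsilon>0$ there are $R,N\ge 0$ such that $d(x,y)\ge R$ implies $|\{g:d(x,gx)\le\epsilon,d(y,gy)\le\epsilon\}|\le N$. For cobounded actions, $X\preceq X'$ if there is a coarsely $G$-equivariant coarsely Lipschitz map $X'\to X$; $X\sim X'$ if $X\preceq X'\preceq X$. A cobounded acylindrical action on a hyperbolic space is largest if its class dominates ($\succeq$) the class of every cobounded acylindrical action of $G$ on a hyperbolic space. The structure $\mathfrak S$ is fixed to be a maximized one (Abbott–Behrstock–Durham; every hierarchically hyperbolic group has one), so that $G\curvearrowright\mathcal C(S)$, with $S$ the $\sqsubseteq$-maximal element, is a largest acylindrical action. Write $\mathrm{diam}_S(\pi_S(h))$ for the diameter in $\mathcal C(S)$ of the image of $h$. **The two topologies.** Fix $o\in G$ and a uniform constant $D$ such that every $\xi\in\partial_\kappa G$ is represented by a $D$-median ray $h$ from $o$ with $\mathrm{diam}_S(\pi_S(h))=\infty$. - $\mathcal T_{med}$ (coarse median topology) is the (sequential) topology on $\partial_\kappa G$ defined by the convergence: for such representatives $h_n$ of $\xi_n$ and $h$ of $\xi$, $\xi_n\to\xi$ if and only if $\liminf_{n\to\infty}\sup\{d_G(o,\mu(o,h_n(s),h(t))):s,t\in\mathbb R_{\ge0}\}=\infty$. - The projection of every $\kappa$-Morse median quasi-geodesic ray to $\mathcal C(S)$ defines a point of $\partial_\infty\mathcal C(S)$, and two such rays define the same point iff they are $\kappa$-close. This gives an injection $\partial\pi:\partial_\kappa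 G\to\partial_\infty\mathcal C(S)$, $[h]\mapsto[\pi_S\circ h]$, and $\mathcal T(G,[\mathcal C(S)])$ is the pull-back under $\partial\pi$ of the visual topology. *)

theory Defs
  imports "HOL-Analysis.Analysis" "HOL-Algebra.Group_Action" "HOL-Algebra.Generated_Groups"
begin

section \<open>Metric preliminaries\<close>

text \<open>
  Spaces are values of the library type \<open>'a metric\<close>, so that several of them (the spaces
  \<open>\<C>(W)\<close> of a hierarchically hyperbolic structure) can be handled at once.
  \<open>set_dist\<close> is only ever meant for nonempty sets.
\<close>

definition set_dist :: "'a metric \<Rightarrow> 'a set \<Rightarrow> 'a set \<Rightarrow> real" where
  "set_dist X A B = (INF p\<in>A \<times> B. mdist X (fst p) (snd p))"

definition mdiam :: "'a metric \<Rightarrow> 'a set \<Rightarrow> ereal" where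
  "mdiam X A = (SUP p\<in>A \<times> A. ereal (mdist X (fst p) (snd p)))"

definition hausdorff_le :: "'a metric \<Rightarrow> real \<Rightarrow> 'a set \<Rightarrow> 'a set \<Rightarrow> bool" where
  "hausdorff_le X r A B \<longleftrightarrow>
     (\<forall>a\<in>A. \<exists>b\<in>B. mdist X a b \<le> r) \<and> (\<forall>b\<in>B. \<exists>a\<in>A. mdist X a b \<le> r)"

definition is_geodesic :: "'a metric \<Rightarrow> 'a set \<Rightarrow> 'a \<Rightarrow> 'a \<Rightarrow> bool" where
  "is_geodesic X P x y \<longleftrightarrow>
     (\<exists>L \<gamma>. 0 \<le> L \<and> \<gamma> \<in> {0..L} \<rightarrow> mspace X \<and> \<gamma> 0 = x \<and> \<gamma> L = y \<and>
        (\<forall>s\<in>{0..L}. \<forall>t\<in>{0..L}. mdist X (\<gamma> s) (\<gamma> t) = \<bar>s - t\<bar>) \<and> P = \<gamma> ` {0..(L::real)})"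

definition geodesic_space :: "'a metric \<Rightarrow> bool" where
  "geodesic_space X \<longleftrightarrow> (\<forall>x\<in>mspace X. \<forall>y\<in>mspace X. \<exists>P. is_geodesic X P x y)"

definition quasi_geodesic :: "'a metric \<Rightarrow> real \<Rightarrow> real \<Rightarrow> real set \<Rightarrow> (real \<Rightarrow> 'a) \<Rightarrow> bool" where
  "quasi_geodesic X K C I \<gamma> \<longleftrightarrow>
     1 \<le> K \<and> 0 \<le> C \<and> \<gamma> \<in> I \<rightarrow> mspace X \<and>
     (\<forall>s\<in>I. \<forall>t\<in>I. \<bar>s - t\<bar> / K - C \<le> mdist X (\<gamma> s) (\<gamma> t) \<and>
                    mdist X (\<gamma> s) (\<gamma> t) \<le> K * \<bar>s - t\<bar> + C)"

definition quasi_geodesic_space :: "'a metric \<Rightarrow> bool" where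
  "quasi_geodesic_space X \<longleftrightarrow>
     (\<exists>K C. \<forall>x\<in>mspace X. \<forall>y\<in>mspace X. \<exists>a b \<gamma>.
        a \<le> b \<and> quasi_geodesic X K C {a..b} \<gamma> \<and> \<gamma> a = x \<and> \<gamma> b = y)"


section \<open>The word metric\<close>

definition word_length :: "('g, 'm) monoid_scheme \<Rightarrow> 'g set \<Rightarrow> 'g \<Rightarrow> nat" where
  "word_length G A g =
     (LEAST n. \<exists>ws. set ws \<subseteq> A \<union> m_inv G ` A \<and> length ws = n \<and> foldr (mult G) ws \<one>\<^bsub>G\<^esub> = g)"

text \<open>
  The distance function is cut off outside the carrier because the library's \<open>'a metric\<close>
  demands symmetry and nonnegativity on the whole type.
\<close>

definition word_metric :: "('g, 'm) monoid_scheme \<Rightarrow> 'g set \<Rightarrow> 'g metric" where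
  "word_metric G A = metric (carrier G, \<lambda>g h.
     if g \<in> carrier G \<and> h \<in> carrier G then real (word_length G A (m_inv G g \<otimes>\<^bsub>G\<^esub> h)) else 0)"

context group
begin

lemma foldr_mult_closed:
  "set ws \<subseteq> carrier G \<Longrightarrow> foldr (mult G) ws \<one> \<in> carrier G"
  by (induction ws) auto

lemma foldr_mult_append:
  "set us \<subseteq> carrier G \<Longrightarrow> set vs \<subseteq> carrier G \<Longrightarrow>
     foldr (mult G) (us @ vs) \<one> = foldr (mult G) us \<one> \<otimes> foldr (mult G) vs \<one>"
  by (induction us) (auto simp: foldr_mult_closed m_assoc simp del: foldr_append)

lemma foldr_mult_inv:
  "set ws \<subseteq> carrier G \<Longrightarrow>
     foldr (mult G) (rev (map (m_inv G) ws)) \<one> = inv (foldr (mult G) ws \<one>)"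
proof (induction ws)
  case (Cons w ws)
  then have "set (rev (map (m_inv G) ws)) \<subseteq> carrier G" "set [inv w] \<subseteq> carrier G"
    by auto
  from foldr_mult_append[OF this] Cons show ?case
    by (simp add: inv_mult_group foldr_mult_closed del: foldr_append)
qed simp

context
  fixes A
  assumes A: "A \<subseteq> carrier G"
begin

definition word_for :: "'a \<Rightarrow> 'a list \<Rightarrow> bool" where
  "word_for g ws \<longleftrightarrow> set ws \<subseteq> A \<union> m_inv G ` A \<and> foldr (mult G) ws \<one> = g"

lemma word_for_carrier: "word_for g ws \<Longrightarrow> set ws \<subseteq> carrier G"
  using A by (auto simp: word_for_def)

lemma word_for_append:
  assumes "word_for g us" "word_for h vs"
  shows "word_for (g \<otimes> h) (us @ vs)"
  using assms foldr_mult_append[of us vs] word_for_carrier[OF assms(1)] word_for_carrier[OF assms(2)]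
  by (auto simp: word_for_def simp del: foldr_append)

lemma word_for_inv:
  assumes "word_for g ws"
  shows "word_for (inv g) (rev (map (m_inv G) ws))"
  using assms foldr_mult_inv[OF word_for_carrier[OF assms]] A
  by (fastforce simp: word_for_def)

lemma word_for_exists:
  assumes "g \<in> generate G A"
  shows "\<exists>ws. word_for g ws"
  using assms
proof induction
  case one
  show ?case by (rule exI[of _ "[]"]) (simp add: word_for_def)
next
  case (incl h)
  then show ?case using A by (intro exI[of _ "[h]"]) (auto simp: word_for_def)
next
  case (inv h)
  then show ?case using A by (intro exI[of _ "[inv h]"]) (auto simp: word_for_def)
next
  case (eng h1 h2)
  then show ?case using word_for_append by blast
qed

lemma word_length_le: "word_for g ws \<Longrightarrow> word_length G A g \<le> length ws"
  unfolding word_length_def word_for_def by (rule Least_le) auto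

lemma word_length_attained:
  assumes "g \<in> generate G A"
  shows "\<exists>ws. word_for g ws \<and> length ws = word_length G A g"
proof -
  have "\<exists>n ws. set ws \<subseteq> A \<union> m_inv G ` A \<and> length ws = n \<and> foldr (mult G) ws \<one> = g"
    using word_for_exists[OF assms] by (auto simp: word_for_def)
  from LeastI_ex[OF this] show ?thesis
    unfolding word_length_def word_for_def by blast
qed

lemma Metric_space_word_metric:
  assumes gen: "generate G A = carrier G"
  shows "Metric_space (carrier G) (\<lambda>g h.
     if g \<in> carrier G \<and> h \<in> carrier G then real (word_length G A (inv g \<otimes> h)) else 0)"
proof -
  have sym_le: "word_length G A (inv g) \<le> word_length G A g" if "g \<in> carrier G" for g
    using word_length_attained[of g] that gen word_for_inv word_length_le
    by (metis length_map length_rev)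
  have sym: "word_length G A (inv g \<otimes> h) = word_length G A (inv h \<otimes> g)"
    if "g \<in> carrier G" "h \<in> carrier G" for g h
  proof -
    have "inv (inv g \<otimes> h) = inv h \<otimes> g" "inv (inv h \<otimes> g) = inv g \<otimes> h"
      using that by (simp_all add: inv_mult_group)
    with sym_le[of "inv g \<otimes> h"] sym_le[of "inv h \<otimes> g"] that show ?thesis
      by (simp add: inv_mult_group)
  qed
  have zero: "word_length G A g = 0 \<longleftrightarrow> g = \<one>" if "g \<in> carrier G" for g
  proof
    assume "word_length G A g = 0"
    with word_length_attained[of g] that gen show "g = \<one>"
      by (auto simp: word_for_def)
  next
    assume "g = \<one>"
    then have "word_for g []" by (simp add: word_for_def)
    from word_length_le[OF this] show "word_length G A g = 0" by simp
  qed
  have mult_le: "word_length G A (g \<otimes> h) \<le> word_length G A g + word_length G A h"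
    if "g \<in> carrier G" "h \<in> carrier G" for g h
    using word_length_attained[of g] word_length_attained[of h] that gen
      word_for_append word_length_le by (metis length_append)
  have tri: "word_length G A (inv x \<otimes> z) \<le> word_length G A (inv x \<otimes> y) + word_length G A (inv y \<otimes> z)"
    if "x \<in> carrier G" "y \<in> carrier G" "z \<in> carrier G" for x y z
  proof -
    have "inv x \<otimes> z = (inv x \<otimes> y) \<otimes> (inv y \<otimes> z)"
      using that by (metis inv_closed inv_solve_left m_assoc m_closed)
    with mult_le[of "inv x \<otimes> y" "inv y \<otimes> z"] that show ?thesis by simp
  qed
  show ?thesis
  proof
    fix x y assume "x \<in> carrier G" "y \<in> carrier G"
    then show "((if x \<in> carrier G \<and> y \<in> carrier G then real (word_length G A (inv x \<otimes> y)) else 0) = 0)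
        \<longleftrightarrow> x = y"
      using zero[of "inv x \<otimes> y"] by (auto, metis inv_equality inv_inv inv_closed)
  next
    fix x y z assume "x \<in> carrier G" "y \<in> carrier G" "z \<in> carrier G"
    then show "(if x \<in> carrier G \<and> z \<in> carrier G then real (word_length G A (inv x \<otimes> z)) else 0)
       \<le> (if x \<in> carrier G \<and> y \<in> carrier G then real (word_length G A (inv x \<otimes> y)) else 0)
        + (if y \<in> carrier G \<and> z \<in> carrier G then real (word_length G A (inv y \<otimes> z)) else 0)"
      using tri[of x y z] by simp
  qed (auto simp: sym)
qed

lemma mspace_word_metric: "generate G A = carrier G \<Longrightarrow> mspace (word_metric G A) = carrier G"
  unfolding word_metric_def by (rule Metric_space.mspace_metric[OF Metric_space_word_metric])

lemma mdist_word_metric: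
  "generate G A = carrier G \<Longrightarrow> g \<in> carrier G \<Longrightarrow> h \<in> carrier G \<Longrightarrow>
     mdist (word_metric G A) g h = real (word_length G A (inv g \<otimes> h))"
  unfolding word_metric_def by (subst Metric_space.mdist_metric[OF Metric_space_word_metric]) auto

end

end


section \<open>The \<open>\<kappa>\<close>-Morse boundary\<close>

definition sublinear_fun :: "(real \<Rightarrow> real) \<Rightarrow> bool" where
  "sublinear_fun \<kappa> \<longleftrightarrow>
     (\<forall>t\<ge>0. 0 \<le> \<kappa> t) \<and> mono_on {0..} \<kappa> \<and> concave_on {0..} \<kappa> \<and> ((\<lambda>t. \<kappa> t / t) \<longlongrightarrow> 0) at_top"

definition kappa_nbhd ::
  "'a metric \<Rightarrow> 'a \<Rightarrow> (real \<Rightarrow> real) \<Rightarrow> 'a set \<Rightarrow> real \<Rightarrow> 'a set" where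
  "kappa_nbhd Y p \<kappa> Z n = {y \<in> mspace Y. set_dist Y {y} Z \<le> n * \<kappa> (mdist Y p y)}"

definition kappa_Morse :: "'a metric \<Rightarrow> 'a \<Rightarrow> (real \<Rightarrow> real) \<Rightarrow> 'a set \<Rightarrow> bool" where
  "kappa_Morse Y p \<kappa> Z \<longleftrightarrow>
     (\<exists>m :: real \<Rightarrow> real \<Rightarrow> real. (\<forall>K C. 0 \<le> m K C) \<and>
        (\<forall>K C a b \<gamma>. a \<le> b \<and> quasi_geodesic Y K C {a..b} \<gamma> \<and> \<gamma> a \<in> Z \<and> \<gamma> b \<in> Z \<longrightarrow>
           \<gamma> ` {a..b} \<subseteq> kappa_nbhd Y p \<kappa> Z (m K C)))"

text \<open>Rays are total functions on the reals of which only the restriction to \<open>{0..}\<close> matters.\<close>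

definition kappa_Morse_rays :: "'a metric \<Rightarrow> 'a \<Rightarrow> (real \<Rightarrow> real) \<Rightarrow> (real \<Rightarrow> 'a) set" where
  "kappa_Morse_rays Y p \<kappa> =
     {h. (\<exists>K C. quasi_geodesic Y K C {0..} h) \<and> kappa_Morse Y p \<kappa> (h ` {0..})}"

definition kappa_fellow_travel ::
  "'a metric \<Rightarrow> 'a \<Rightarrow> (real \<Rightarrow> real) \<Rightarrow> (real \<Rightarrow> 'a) \<Rightarrow> (real \<Rightarrow> 'a) \<Rightarrow> bool" where
  "kappa_fellow_travel Y p \<kappa> h h' \<longleftrightarrow>
     (\<exists>n\<ge>0. h ` {0..} \<subseteq> kappa_nbhd Y p \<kappa> (h' ` {0..}) n) \<and>
     (\<exists>n\<ge>0. h' ` {0..} \<subseteq> kappa_nbhd Y p \<kappa> (h ` {0..}) n)"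

definition kappa_boundary :: "'a metric \<Rightarrow> 'a \<Rightarrow> (real \<Rightarrow> real) \<Rightarrow> (real \<Rightarrow> 'a) set set" where
  "kappa_boundary Y p \<kappa> =
     kappa_Morse_rays Y p \<kappa> //
       {(h, h'). h \<in> kappa_Morse_rays Y p \<kappa> \<and> h' \<in> kappa_Morse_rays Y p \<kappa> \<and>
                 kappa_fellow_travel Y p \<kappa> h h'}"


section \<open>Coarse medians\<close>

definition coarse_median :: "'a metric \<Rightarrow> ('a \<Rightarrow> 'a \<Rightarrow> 'a \<Rightarrow> 'a) \<Rightarrow> bool" where
  "coarse_median Y \<mu> \<longleftrightarrow>
     (\<forall>a\<in>mspace Y. \<forall>b\<in>mspace Y. \<forall>c\<in>mspace Y. \<mu> a b c \<in> mspace Y) \<and>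
     (\<forall>a\<in>mspace Y. \<forall>b\<in>mspace Y. \<mu> a a b = a) \<and>
     (\<forall>a\<in>mspace Y. \<forall>b\<in>mspace Y. \<forall>c\<in>mspace Y. \<mu> a b c = \<mu> b a c \<and> \<mu> a b c = \<mu> a c b) \<and>
     (\<exists>C. \<forall>a\<in>mspace Y. \<forall>b\<in>mspace Y. \<forall>c\<in>mspace Y. \<forall>x\<in>mspace Y.
        mdist Y (\<mu> (\<mu> a x b) x c) (\<mu> a x (\<mu> b x c)) \<le> C \<and>
        mdist Y (\<mu> a b c) (\<mu> x b c) \<le> C * mdist Y a x + C)"

definition real_median :: "real \<Rightarrow> real \<Rightarrow> real \<Rightarrow> real" where
  "real_median a b c = max (min a b) (min (max a b) c)"

definition median_ray ::
  "'a metric \<Rightarrow> ('a \<Rightarrow> 'a \<Rightarrow> 'a \<Rightarrow> 'a) \<Rightarrow> real \<Rightarrow> (real \<Rightarrow> 'a) \<Rightarrow> bool" where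
  "median_ray Y \<mu> D h \<longleftrightarrow>
     quasi_geodesic Y D D {0..} h \<and>
     (\<forall>a\<ge>0. \<forall>b\<ge>0. \<forall>c\<ge>0. mdist Y (h (real_median a b c)) (\<mu> (h a) (h b) (h c)) \<le> D)"


section \<open>Gromov hyperbolic spaces and their boundaries\<close>

definition gromov_product :: "'a metric \<Rightarrow> 'a \<Rightarrow> 'a \<Rightarrow> 'a \<Rightarrow> real" where
  "gromov_product X p x y = (mdist X p x + mdist X p y - mdist X x y) / 2"

definition hyperbolic :: "real \<Rightarrow> 'a metric \<Rightarrow> bool" where
  "hyperbolic \<delta> X \<longleftrightarrow>
     (\<forall>p\<in>mspace X. \<forall>x\<in>mspace X. \<forall>y\<in>mspace X. \<forall>z\<in>mspace X.
        gromov_product X p x y \<ge> min (gromov_product X p x z) (gromov_product X p z y) - \<delta>)"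

definition seqs_to_infinity :: "'a metric \<Rightarrow> 'a \<Rightarrow> (nat \<Rightarrow> 'a) set" where
  "seqs_to_infinity X p =
     {x. range x \<subseteq> mspace X \<and>
         filterlim (\<lambda>(i, j). gromov_product X p (x i) (x j)) at_top (sequentially \<times>\<^sub>F sequentially)}"

definition gromov_boundary :: "'a metric \<Rightarrow> 'a \<Rightarrow> (nat \<Rightarrow> 'a) set set" where
  "gromov_boundary X p =
     seqs_to_infinity X p //
       {(x, y). x \<in> seqs_to_infinity X p \<and> y \<in> seqs_to_infinity X p \<and>
                filterlim (\<lambda>i. gromov_product X p (x i) (y i)) at_top sequentially}"

definition boundary_product ::
  "'a metric \<Rightarrow> 'a \<Rightarrow> (nat \<Rightarrow> 'a) set \<Rightarrow> (nat \<Rightarrow> 'a) set \<Rightarrow> ereal" where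
  "boundary_product X p \<xi> \<eta> =
     (INF x\<in>\<xi>. INF y\<in>\<eta>. liminf (\<lambda>i. ereal (gromov_product X p (x i) (y i))))"

definition visual_topology :: "'a metric \<Rightarrow> 'a \<Rightarrow> (nat \<Rightarrow> 'a) set topology" where
  "visual_topology X p =
     topology (\<lambda>U. U \<subseteq> gromov_boundary X p \<and>
       (\<forall>\<xi>\<in>U. \<exists>R::real. {\<eta> \<in> gromov_boundary X p. boundary_product X p \<xi> \<eta> > ereal R} \<subseteq> U))"

lemma openin_visual_topology:
  "openin (visual_topology X p) U \<longleftrightarrow> U \<subseteq> gromov_boundary X p \<and>
     (\<forall>\<xi>\<in>U. \<exists>R::real. {\<eta> \<in> gromov_boundary X p. boundary_product X p \<xi> \<eta> > ereal R} \<subseteq> U)"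
proof -
  let ?B = "\<lambda>\<xi> R. {\<eta> \<in> gromov_boundary X p. boundary_product X p \<xi> \<eta> > ereal R}"
  let ?P = "\<lambda>U. U \<subseteq> gromov_boundary X p \<and> (\<forall>\<xi>\<in>U. \<exists>R::real. ?B \<xi> R \<subseteq> U)"
  have mono: "?B \<xi> R' \<subseteq> ?B \<xi> R" if "R \<le> R'" for \<xi> R R'
  proof -
    have "ereal R \<le> ereal R'" using that by simp
    then show ?thesis using le_less_trans by blast
  qed
  have "istopology ?P"
    unfolding istopology_def
  proof (intro conjI allI impI)
    fix S T assume S: "?P S" and T: "?P T"
    show "S \<inter> T \<subseteq> gromov_boundary X p" using S by blast
    show "\<forall>\<xi>\<in>S \<inter> T. \<exists>R::real. ?B \<xi> R \<subseteq> S \<inter> T"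
    proof
      fix \<xi> assume "\<xi> \<in> S \<inter> T"
      then obtain R R' where R: "?B \<xi> R \<subseteq> S" "?B \<xi> R' \<subseteq> T" using S T by blast
      have "?B \<xi> (max R R') \<subseteq> ?B \<xi> R" "?B \<xi> (max R R') \<subseteq> ?B \<xi> R'" by (intro mono; simp)+
      with R show "\<exists>R::real. ?B \<xi> R \<subseteq> S \<inter> T" by blast
    qed
  next
    fix \<K> assume K: "\<forall>U\<in>\<K>. ?P U"
    then show "\<Union>\<K> \<subseteq> gromov_boundary X p" by blast
    show "\<forall>\<xi>\<in>\<Union>\<K>. \<exists>R::real. ?B \<xi> R \<subseteq> \<Union>\<K>" using K by (meson Union_upper Union_iff order_trans)
  qed
  then show ?thesis unfolding visual_topology_def by (simp add: topology_inverse')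
qed

definition defines_boundary_point ::
  "'a metric \<Rightarrow> 'a \<Rightarrow> real \<Rightarrow> (real \<Rightarrow> 'a) \<Rightarrow> (nat \<Rightarrow> 'a) set \<Rightarrow> bool" where
  "defines_boundary_point X p a \<gamma> \<xi> \<longleftrightarrow>
     \<xi> \<in> gromov_boundary X p \<and>
     (\<forall>t. incseq t \<and> (\<forall>i. a \<le> t i) \<and> filterlim t at_top sequentially \<longrightarrow> (\<lambda>i::nat. \<gamma> (t i)) \<in> \<xi>)"


section \<open>Hierarchically hyperbolic spaces\<close>

text \<open>
  \<open>hrho H V W\<close> is the set \<open>\<rho>\<^sup>V\<^sub>W \<subseteq> \<C>(W)\<close> (for \<open>V\<close> properly nested in, or transverse to, \<open>W\<close>);
  \<open>hrho_map H W V\<close> is the map \<open>\<rho>\<^sup>W\<^sub>V\<close> from \<open>\<C>(W)\<close> to subsets of \<open>\<C>(V)\<close> (for \<open>V\<close> properly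
  nested in \<open>W\<close>).
\<close>

record ('a, 'i, 'x) hhs =
  hindex :: "'i set"
  hspace :: "'i \<Rightarrow> 'x metric"
  hproj :: "'i \<Rightarrow> 'a \<Rightarrow> 'x set"
  hnest :: "'i \<Rightarrow> 'i \<Rightarrow> bool"
  horth :: "'i \<Rightarrow> 'i \<Rightarrow> bool"
  hrho :: "'i \<Rightarrow> 'i \<Rightarrow> 'x set"
  hrho_map :: "'i \<Rightarrow> 'i \<Rightarrow> 'x \<Rightarrow> 'x set"

definition hpnest :: "('a, 'i, 'x, 'z) hhs_scheme \<Rightarrow> 'i \<Rightarrow> 'i \<Rightarrow> bool" where
  "hpnest H V W \<longleftrightarrow> hnest H V W \<and> V \<noteq> W"

definition htransverse :: "('a, 'i, 'x, 'z) hhs_scheme \<Rightarrow> 'i \<Rightarrow> 'i \<Rightarrow> bool" where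
  "htransverse H V W \<longleftrightarrow> \<not> horth H V W \<and> \<not> hnest H V W \<and> \<not> hnest H W V"

definition hdist :: "('a, 'i, 'x, 'z) hhs_scheme \<Rightarrow> 'i \<Rightarrow> 'a \<Rightarrow> 'a \<Rightarrow> real" where
  "hdist H W x y = set_dist (hspace H W) (hproj H W x) (hproj H W y)"

definition hmaximal :: "('a, 'i, 'x, 'z) hhs_scheme \<Rightarrow> 'i \<Rightarrow> bool" where
  "hmaximal H S \<longleftrightarrow> S \<in> hindex H \<and> (\<forall>V\<in>hindex H. hnest H S V \<longrightarrow> V = S)"

definition htop :: "('a, 'i, 'x, 'z) hhs_scheme \<Rightarrow> 'i" where
  "htop H = (THE S. hmaximal H S)"

definition hhs_projections ::
  "'a metric \<Rightarrow> ('a, 'i, 'x, 'z) hhs_scheme \<Rightarrow> real \<Rightarrow> real \<Rightarrow> real \<Rightarrow> bool" where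
  "hhs_projections Y H \<delta> \<xi>\<^sub>0 K \<longleftrightarrow>
     (\<forall>W\<in>hindex H.
        hyperbolic \<delta> (hspace H W) \<and> geodesic_space (hspace H W) \<and>
        (\<forall>x\<in>mspace Y. hproj H W x \<subseteq> mspace (hspace H W) \<and> hproj H W x \<noteq> {} \<and>
                      mdiam (hspace H W) (hproj H W x) \<le> ereal \<xi>\<^sub>0) \<and>
        (\<forall>x\<in>mspace Y. \<forall>y\<in>mspace Y. hdist H W x y \<le> K * mdist Y x y + K) \<and>
        (\<forall>P. \<forall>a\<in>\<Union>(hproj H W ` mspace Y). \<forall>b\<in>\<Union>(hproj H W ` mspace Y).
           is_geodesic (hspace H W) P a b \<longrightarrow>
             (\<forall>p\<in>P. set_dist (hspace H W) {p} (\<Union>(hproj H W ` mspace Y)) \<le> K)))"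

definition hhs_nesting :: "('a, 'i, 'x, 'z) hhs_scheme \<Rightarrow> real \<Rightarrow> bool" where
  "hhs_nesting H \<xi>\<^sub>0 \<longleftrightarrow>
     reflp_on (hindex H) (hnest H) \<and> antisymp_on (hindex H) (hnest H) \<and>
     transp_on (hindex H) (hnest H) \<and> (\<exists>!S. hmaximal H S) \<and>
     (\<forall>V\<in>hindex H. \<forall>W\<in>hindex H. hpnest H V W \<longrightarrow>
        hrho H V W \<subseteq> mspace (hspace H W) \<and> hrho H V W \<noteq> {} \<and>
        mdiam (hspace H W) (hrho H V W) \<le> ereal \<xi>\<^sub>0 \<and>
        (\<forall>p\<in>mspace (hspace H W). hrho_map H W V p \<subseteq> mspace (hspace H V) \<and> hrho_map H W V p \<noteq> {}))"

definition hhs_orthogonality :: "('a, 'i, 'x, 'z) hhs_scheme \<Rightarrow> bool" where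
  "hhs_orthogonality H \<longleftrightarrow>
     symp_on (hindex H) (horth H) \<and> irreflp_on (hindex H) (horth H) \<and>
     (\<forall>V\<in>hindex H. \<forall>W\<in>hindex H. \<forall>U\<in>hindex H. hnest H V W \<and> horth H W U \<longrightarrow> horth H V U) \<and>
     (\<forall>T\<in>hindex H. \<forall>U\<in>hindex H. hnest H U T \<and> (\<exists>V\<in>hindex H. hnest H V T \<and> horth H V U) \<longrightarrow>
        (\<exists>W\<in>hindex H. hpnest H W T \<and>
           (\<forall>V\<in>hindex H. horth H V U \<and> hnest H V T \<longrightarrow> hnest H V W))) \<and>
     (\<forall>V\<in>hindex H. \<forall>W\<in>hindex H. horth H V W \<longrightarrow> \<not> hnest H V W \<and> \<not> hnest H W V)"

definition hhs_consistency ::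
  "'a metric \<Rightarrow> ('a, 'i, 'x, 'z) hhs_scheme \<Rightarrow> real \<Rightarrow> real \<Rightarrow> bool" where
  "hhs_consistency Y H \<xi>\<^sub>0 \<kappa>\<^sub>0 \<longleftrightarrow>
     (\<forall>V\<in>hindex H. \<forall>W\<in>hindex H. htransverse H V W \<longrightarrow>
        hrho H V W \<subseteq> mspace (hspace H W) \<and> hrho H V W \<noteq> {} \<and>
        mdiam (hspace H W) (hrho H V W) \<le> ereal \<xi>\<^sub>0 \<and>
        (\<forall>x\<in>mspace Y. min (set_dist (hspace H W) (hproj H W x) (hrho H V W))
                          (set_dist (hspace H V) (hproj H V x) (hrho H W V)) \<le> \<kappa>\<^sub>0)) \<and>
     (\<forall>V\<in>hindex H. \<forall>W\<in>hindex H. hpnest H V W \<longrightarrow>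
        (\<forall>x\<in>mspace Y. min (ereal (set_dist (hspace H W) (hproj H W x) (hrho H V W)))
             (mdiam (hspace H V) (hproj H V x \<union> \<Union>(hrho_map H W V ` hproj H W x))) \<le> ereal \<kappa>\<^sub>0)) \<and>
     (\<forall>U\<in>hindex H. \<forall>V\<in>hindex H. \<forall>W\<in>hindex H.
        hnest H U V \<and> (hpnest H V W \<or> htransverse H V W \<and> \<not> horth H W U) \<longrightarrow>
          set_dist (hspace H W) (hrho H U W) (hrho H V W) \<le> \<kappa>\<^sub>0)"

definition hhs_complexity :: "('a, 'i, 'x, 'z) hhs_scheme \<Rightarrow> nat \<Rightarrow> bool" where
  "hhs_complexity H n \<longleftrightarrow>
     (\<forall>F\<subseteq>hindex H. (\<forall>V\<in>F. \<forall>W\<in>F. hnest H V W \<or> hnest H W V) \<longrightarrow> finite F \<and> card F \<le> n)"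

text \<open>
  The family \<open>T\<^sub>1, \<dots>\<close> is allowed to have fewer than \<open>\<lfloor>N\<rfloor>\<close> members: exactly \<open>\<lfloor>N\<rfloor>\<close> of them
  need not exist, for instance when nothing is properly nested in \<open>W\<close>.
\<close>

definition hhs_large_links ::
  "'a metric \<Rightarrow> ('a, 'i, 'x, 'z) hhs_scheme \<Rightarrow> real \<Rightarrow> real \<Rightarrow> bool" where
  "hhs_large_links Y H \<Lambda> E \<longleftrightarrow>
     (\<forall>W\<in>hindex H. \<forall>x\<in>mspace Y. \<forall>x'\<in>mspace Y.
        let N = \<Lambda> * hdist H W x x' + \<Lambda> in
        \<exists>F. F \<subseteq> {T \<in> hindex H. hpnest H T W} \<and> finite F \<and> int (card F) \<le> \<lfloor>N\<rfloor> \<and>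
          (\<forall>T\<in>hindex H. hpnest H T W \<longrightarrow> (\<exists>T'\<in>F. hnest H T T') \<or> hdist H T x x' < E) \<and>
          (\<forall>T\<in>F. set_dist (hspace H W) (hproj H W x) (hrho H T W) \<le> N))"

definition hhs_bounded_geodesic_image :: "('a, 'i, 'x, 'z) hhs_scheme \<Rightarrow> real \<Rightarrow> bool" where
  "hhs_bounded_geodesic_image H E \<longleftrightarrow>
     (\<forall>V\<in>hindex H. \<forall>W\<in>hindex H. hpnest H V W \<longrightarrow>
        (\<forall>P a b. is_geodesic (hspace H W) P a b \<longrightarrow>
           mdiam (hspace H V) (\<Union>(hrho_map H W V ` P)) \<le> ereal E \<or>
           (\<exists>p\<in>P. set_dist (hspace H W) {p} (hrho H V W) \<le> E)))"

definition hhs_partial_realization ::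
  "'a metric \<Rightarrow> ('a, 'i, 'x, 'z) hhs_scheme \<Rightarrow> real \<Rightarrow> bool" where
  "hhs_partial_realization Y H \<alpha> \<longleftrightarrow>
     (\<forall>F\<subseteq>hindex H. \<forall>p. pairwise (horth H) F \<and> (\<forall>V\<in>F. p V \<in> \<Union>(hproj H V ` mspace Y)) \<longrightarrow>
        (\<exists>x\<in>mspace Y. \<forall>V\<in>F.
           set_dist (hspace H V) (hproj H V x) {p V} \<le> \<alpha> \<and>
           (\<forall>W\<in>hindex H. hpnest H V W \<or> htransverse H W V \<longrightarrow>
              set_dist (hspace H W) (hproj H W x) (hrho H V W) \<le> \<alpha>)))"

definition hhs_uniqueness :: "'a metric \<Rightarrow> ('a, 'i, 'x, 'z) hhs_scheme \<Rightarrow> bool" where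
  "hhs_uniqueness Y H \<longleftrightarrow>
     (\<exists>\<theta> :: real \<Rightarrow> real. \<forall>k\<ge>0. \<forall>x\<in>mspace Y. \<forall>y\<in>mspace Y.
        mdist Y x y \<ge> \<theta> k \<longrightarrow> (\<exists>V\<in>hindex H. hdist H V x y \<ge> k))"

definition hierarchically_hyperbolic_space ::
  "'a metric \<Rightarrow> ('a, 'i, 'x, 'z) hhs_scheme \<Rightarrow> bool" where
  "hierarchically_hyperbolic_space Y H \<longleftrightarrow>
     quasi_geodesic_space Y \<and>
     (\<exists>\<delta>\<ge>0. \<exists>\<xi>\<^sub>0\<ge>0. \<exists>K\<ge>0. \<exists>\<kappa>\<^sub>0\<ge>0. \<exists>n. \<exists>\<Lambda>\<ge>0. \<exists>E\<ge>0. \<exists>\<alpha>\<ge>0.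
        hhs_projections Y H \<delta> \<xi>\<^sub>0 K \<and> hhs_nesting H \<xi>\<^sub>0 \<and> hhs_orthogonality H \<and>
        hhs_consistency Y H \<xi>\<^sub>0 \<kappa>\<^sub>0 \<and> hhs_complexity H n \<and> hhs_large_links Y H \<Lambda> E \<and>
        hhs_bounded_geodesic_image H E \<and> hhs_partial_realization Y H \<alpha> \<and> hhs_uniqueness Y H)"


section \<open>Hierarchically hyperbolic groups\<close>

text \<open>
  \<open>hact_index H g\<close> is the action of \<open>g\<close> on the index set and \<open>hact_space H g W\<close> the isometry
  \<open>g: \<C>(W) \<rightarrow> \<C>(gW)\<close>.
\<close>

record ('g, 'i, 'x) hhg = "('g, 'i, 'x) hhs" +
  hact_index :: "'g \<Rightarrow> 'i \<Rightarrow> 'i"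
  hact_space :: "'g \<Rightarrow> 'i \<Rightarrow> 'x \<Rightarrow> 'x"

definition hhg_action ::
  "('g, 'm) monoid_scheme \<Rightarrow> ('g, 'i, 'x, 'z) hhg_scheme \<Rightarrow> bool" where
  "hhg_action G H \<longleftrightarrow>
     group_action G (hindex H) (hact_index H) \<and>
     finite (orbits G (hindex H) (hact_index H)) \<and>
     (\<forall>g\<in>carrier G. \<forall>V\<in>hindex H. \<forall>W\<in>hindex H.
        (hnest H V W \<longrightarrow> hnest H (hact_index H g V) (hact_index H g W)) \<and>
        (horth H V W \<longrightarrow> horth H (hact_index H g V) (hact_index H g W)) \<and>
        (htransverse H V W \<longrightarrow> htransverse H (hact_index H g V) (hact_index H g W))) \<and>
     (\<forall>g\<in>carrier G. \<forall>W\<in>hindex H.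
        bij_betw (hact_space H g W) (mspace (hspace H W)) (mspace (hspace H (hact_index H g W))) \<and>
        (\<forall>p\<in>mspace (hspace H W). \<forall>q\<in>mspace (hspace H W).
           mdist (hspace H (hact_index H g W)) (hact_space H g W p) (hact_space H g W q)
             = mdist (hspace H W) p q)) \<and>
     (\<forall>g\<in>carrier G. \<forall>h\<in>carrier G. \<forall>W\<in>hindex H. \<forall>p\<in>mspace (hspace H W).
        hact_space H (g \<otimes>\<^bsub>G\<^esub> h) W p = hact_space H g (hact_index H h W) (hact_space H h W p)) \<and>
     (\<exists>B. \<forall>g\<in>carrier G. \<forall>W\<in>hindex H.
        (\<forall>x\<in>carrier G. hausdorff_le (hspace H (hact_index H g W)) B
           (hact_space H g W ` hproj H W x) (hproj H (hact_index H g W) (g \<otimes>\<^bsub>G\<^esub> x))) \<and>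
        (\<forall>V\<in>hindex H. hpnest H V W \<or> htransverse H V W \<longrightarrow>
           hausdorff_le (hspace H (hact_index H g W)) B
             (hact_space H g W ` hrho H V W) (hrho H (hact_index H g V) (hact_index H g W))))"

definition hierarchically_hyperbolic_group ::
  "('g, 'm) monoid_scheme \<Rightarrow> 'g set \<Rightarrow> ('g, 'i, 'x, 'z) hhg_scheme \<Rightarrow> bool" where
  "hierarchically_hyperbolic_group G A H \<longleftrightarrow>
     group G \<and> finite A \<and> A \<subseteq> carrier G \<and> generate G A = carrier G \<and>
     hierarchically_hyperbolic_space (word_metric G A) H \<and> hhg_action G H"

text \<open>
  A coarse centre of a geodesic triangle is a point within bounded distance of its three sides.
\<close>

definition hierarchical_median ::
  "'a metric \<Rightarrow> ('a, 'i, 'x, 'z) hhs_scheme \<Rightarrow> ('a \<Rightarrow> 'a \<Rightarrow> 'a \<Rightarrow> 'a) \<Rightarrow> bool" where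
  "hierarchical_median Y H \<mu> \<longleftrightarrow>
     (\<exists>r. \<forall>x\<in>mspace Y. \<forall>y\<in>mspace Y. \<forall>z\<in>mspace Y. \<forall>W\<in>hindex H.
        \<exists>a\<in>hproj H W x. \<exists>b\<in>hproj H W y. \<exists>c\<in>hproj H W z. \<exists>P Q R. \<exists>q\<in>mspace (hspace H W).
          is_geodesic (hspace H W) P a b \<and> is_geodesic (hspace H W) Q b c \<and>
          is_geodesic (hspace H W) R c a \<and>
          set_dist (hspace H W) {q} P \<le> r \<and> set_dist (hspace H W) {q} Q \<le> r \<and>
          set_dist (hspace H W) {q} R \<le> r \<and>
          set_dist (hspace H W) (hproj H W (\<mu> x y z)) {q} \<le> r)"


section \<open>Largest acylindrical actions\<close>

definition isometric_action ::
  "('g, 'm) monoid_scheme \<Rightarrow> 'x metric \<Rightarrow> ('g \<Rightarrow> 'x \<Rightarrow> 'x) \<Rightarrow> bool" where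
  "isometric_action G X \<phi> \<longleftrightarrow>
     group_action G (mspace X) \<phi> \<and>
     (\<forall>g\<in>carrier G. \<forall>x\<in>mspace X. \<forall>y\<in>mspace X. mdist X (\<phi> g x) (\<phi> g y) = mdist X x y)"

definition acylindrical ::
  "('g, 'm) monoid_scheme \<Rightarrow> 'x metric \<Rightarrow> ('g \<Rightarrow> 'x \<Rightarrow> 'x) \<Rightarrow> bool" where
  "acylindrical G X \<phi> \<longleftrightarrow>
     (\<forall>\<epsilon>>0. \<exists>R\<ge>0. \<exists>N::nat. \<forall>x\<in>mspace X. \<forall>y\<in>mspace X. mdist X x y \<ge> R \<longrightarrow>
        (let F = {g \<in> carrier G. mdist X x (\<phi> g x) \<le> \<epsilon> \<and> mdist X y (\<phi> g y) \<le> \<epsilon>}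
         in finite F \<and> card F \<le> N))"

definition cobounded ::
  "('g, 'm) monoid_scheme \<Rightarrow> 'x metric \<Rightarrow> ('g \<Rightarrow> 'x \<Rightarrow> 'x) \<Rightarrow> bool" where
  "cobounded G X \<phi> \<longleftrightarrow>
     (\<exists>x\<in>mspace X. \<exists>R. \<forall>y\<in>mspace X. \<exists>g\<in>carrier G. mdist X (\<phi> g x) y \<le> R)"

definition cobounded_acylindrical_hyperbolic ::
  "('g, 'm) monoid_scheme \<Rightarrow> 'x metric \<Rightarrow> ('g \<Rightarrow> 'x \<Rightarrow> 'x) \<Rightarrow> bool" where
  "cobounded_acylindrical_hyperbolic G X \<phi> \<longleftrightarrow>
     geodesic_space X \<and> (\<exists>\<delta>. hyperbolic \<delta> X) \<and>
     isometric_action G X \<phi> \<and> cobounded G X \<phi> \<and> acylindrical G X \<phi>"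

text \<open>\<open>action_le G X \<phi> X' \<phi>'\<close> is \<open>X \<preceq> X'\<close>: there is a suitable map from \<open>X'\<close> to \<open>X\<close>.\<close>

definition action_le ::
  "('g, 'm) monoid_scheme \<Rightarrow> 'x metric \<Rightarrow> ('g \<Rightarrow> 'x \<Rightarrow> 'x) \<Rightarrow> 'y metric \<Rightarrow> ('g \<Rightarrow> 'y \<Rightarrow> 'y) \<Rightarrow> bool"
where
  "action_le G X \<phi> X' \<phi>' \<longleftrightarrow>
     (\<exists>f \<in> mspace X' \<rightarrow> mspace X.
        (\<exists>L. \<forall>x\<in>mspace X'. \<forall>y\<in>mspace X'. mdist X (f x) (f y) \<le> L * mdist X' x y + L) \<and>
        (\<forall>x\<in>mspace X'. \<exists>B. \<forall>g\<in>carrier G. mdist X (f (\<phi>' g x)) (\<phi> g (f x)) \<le> B))"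

text \<open>
  The competing spaces are taken on the fixed type \<open>'g \<times> 'g \<times> real\<close>, as one cannot quantify over
  all types.  Nothing is lost: every cobounded action on a geodesic space is equivalent to the
  action on the Cayley graph of \<open>G\<close> with respect to some (possibly infinite) generating set, and
  that graph can be realised on this type, \<open>(g, a, t)\<close> being a point of the edge from \<open>g\<close> to \<open>ga\<close>.
\<close>

definition largest_acylindrical_action ::
  "('g, 'm) monoid_scheme \<Rightarrow> 'x metric \<Rightarrow> ('g \<Rightarrow> 'x \<Rightarrow> 'x) \<Rightarrow> bool" where
  "largest_acylindrical_action G X \<phi> \<longleftrightarrow>
     cobounded_acylindrical_hyperbolic G X \<phi> \<and>
     (\<forall>(X' :: ('g \<times> 'g \<times> real) metric) \<phi>'.
        cobounded_acylindrical_hyperbolic G X' \<phi>' \<longrightarrow> action_le G X' \<phi>' X \<phi>)"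

text \<open>The restriction makes the isometries extensional, as required by \<^const>\<open>group_action\<close>.\<close>

definition top_action :: "('g, 'i, 'x, 'z) hhg_scheme \<Rightarrow> 'g \<Rightarrow> 'x \<Rightarrow> 'x" where
  "top_action H g = restrict (hact_space H g (htop H)) (mspace (hspace H (htop H)))"


section \<open>The two topologies\<close>

definition good_rays ::
  "'a metric \<Rightarrow> 'a \<Rightarrow> ('a \<Rightarrow> 'a \<Rightarrow> 'a \<Rightarrow> 'a) \<Rightarrow> ('a, 'i, 'x, 'z) hhs_scheme \<Rightarrow> real \<Rightarrow>
     (real \<Rightarrow> 'a) set" where
  "good_rays Y p \<mu> H D =
     {h. median_ray Y \<mu> D h \<and> h 0 = p \<and>
         mdiam (hspace H (htop H)) (\<Union>t\<in>{0..}. hproj H (htop H) (h t)) = \<infinity>}"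

definition median_overlap ::
  "'a metric \<Rightarrow> 'a \<Rightarrow> ('a \<Rightarrow> 'a \<Rightarrow> 'a \<Rightarrow> 'a) \<Rightarrow> (real \<Rightarrow> 'a) \<Rightarrow> (real \<Rightarrow> 'a) \<Rightarrow> ereal" where
  "median_overlap Y p \<mu> h h' = (SUP (s, t)\<in>{0..} \<times> {0..}. ereal (mdist Y p (\<mu> p (h s) (h' t))))"

definition median_converges ::
  "'a metric \<Rightarrow> 'a \<Rightarrow> ('a \<Rightarrow> 'a \<Rightarrow> 'a \<Rightarrow> 'a) \<Rightarrow> ('a, 'i, 'x, 'z) hhs_scheme \<Rightarrow> real \<Rightarrow>
     (nat \<Rightarrow> (real \<Rightarrow> 'a) set) \<Rightarrow> (real \<Rightarrow> 'a) set \<Rightarrow> bool" where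
  "median_converges Y p \<mu> H D \<Xi> \<xi> \<longleftrightarrow>
     (\<forall>h\<^sub>n h. (\<forall>n. h\<^sub>n n \<in> \<Xi> n \<inter> good_rays Y p \<mu> H D) \<and> h \<in> \<xi> \<inter> good_rays Y p \<mu> H D \<longrightarrow>
        liminf (\<lambda>n. median_overlap Y p \<mu> (h\<^sub>n n) h) = \<infinity>)"

definition median_topology ::
  "'a metric \<Rightarrow> 'a \<Rightarrow> (real \<Rightarrow> real) \<Rightarrow> ('a \<Rightarrow> 'a \<Rightarrow> 'a \<Rightarrow> 'a) \<Rightarrow> ('a, 'i, 'x, 'z) hhs_scheme \<Rightarrow> real \<Rightarrow>
     (real \<Rightarrow> 'a) set topology" where
  "median_topology Y p \<kappa> \<mu> H D =
     topology (\<lambda>U. U \<subseteq> kappa_boundary Y p \<kappa> \<and>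
       (\<forall>\<xi>\<in>U. \<forall>\<Xi>. range \<Xi> \<subseteq> kappa_boundary Y p \<kappa> \<and> median_converges Y p \<mu> H D \<Xi> \<xi> \<longrightarrow>
          (\<forall>\<^sub>F n in sequentially. \<Xi> n \<in> U)))"

lemma openin_median_topology:
  "openin (median_topology Y p \<kappa> \<mu> H D) U \<longleftrightarrow> U \<subseteq> kappa_boundary Y p \<kappa> \<and>
       (\<forall>\<xi>\<in>U. \<forall>\<Xi>. range \<Xi> \<subseteq> kappa_boundary Y p \<kappa> \<and> median_converges Y p \<mu> H D \<Xi> \<xi> \<longrightarrow>
          (\<forall>\<^sub>F n in sequentially. \<Xi> n \<in> U))"
proof -
  let ?c = "\<lambda>\<Xi> \<xi>. range \<Xi> \<subseteq> kappa_boundary Y p \<kappa> \<and> median_converges Y p \<mu> H D \<Xi> \<xi>"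
  have "istopology (\<lambda>U. U \<subseteq> kappa_boundary Y p \<kappa> \<and>
       (\<forall>\<xi>\<in>U. \<forall>\<Xi>. ?c \<Xi> \<xi> \<longrightarrow> (\<forall>\<^sub>F n in sequentially. \<Xi> n \<in> U)))" (is "istopology ?P")
    unfolding istopology_def
  proof (intro conjI allI impI)
    fix S T assume S: "?P S" and T: "?P T"
    show "S \<inter> T \<subseteq> kappa_boundary Y p \<kappa>" using S by blast
    show "\<forall>\<xi>\<in>S \<inter> T. \<forall>\<Xi>. ?c \<Xi> \<xi> \<longrightarrow> (\<forall>\<^sub>F n in sequentially. \<Xi> n \<in> S \<inter> T)"
    proof (intro ballI allI impI)
      fix \<xi> \<Xi> assume "\<xi> \<in> S \<inter> T" and c: "?c \<Xi> \<xi>"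
      with S T have "\<forall>\<^sub>F n in sequentially. \<Xi> n \<in> S" "\<forall>\<^sub>F n in sequentially. \<Xi> n \<in> T"
        by blast+
      then show "\<forall>\<^sub>F n in sequentially. \<Xi> n \<in> S \<inter> T"
        by eventually_elim blast
    qed
  next
    fix \<K> assume K: "\<forall>U\<in>\<K>. ?P U"
    then show "\<Union>\<K> \<subseteq> kappa_boundary Y p \<kappa>" by blast
    show "\<forall>\<xi>\<in>\<Union>\<K>. \<forall>\<Xi>. ?c \<Xi> \<xi> \<longrightarrow> (\<forall>\<^sub>F n in sequentially. \<Xi> n \<in> \<Union>\<K>)"
    proof (intro ballI allI impI)
      fix \<xi> \<Xi> assume "\<xi> \<in> \<Union>\<K>" and c: "?c \<Xi> \<xi>"
      then obtain U where U: "U \<in> \<K>" "\<xi> \<in> U" by blast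
      with K c have "\<forall>\<^sub>F n in sequentially. \<Xi> n \<in> U" by blast
      then show "\<forall>\<^sub>F n in sequentially. \<Xi> n \<in> \<Union>\<K>"
        by (rule eventually_mono) (use U in blast)
    qed
  qed
  then show ?thesis unfolding median_topology_def by (simp add: topology_inverse')
qed

text \<open>
  The map \<open>[h] \<mapsto> [\<pi>\<^sub>S \<circ> h]\<close>.  As \<open>\<pi>\<^sub>S\<close> is set-valued, \<open>\<pi>\<^sub>S \<circ> h\<close> stands for any map \<open>\<gamma>\<close> that
  selects a point of \<open>\<pi>\<^sub>S(h(t))\<close> for each \<open>t\<close>.
\<close>

definition boundary_projection ::
  "('a \<Rightarrow> 'a \<Rightarrow> 'a \<Rightarrow> 'a) \<Rightarrow> 'a metric \<Rightarrow> ('a, 'i, 'x, 'z) hhs_scheme \<Rightarrow> 'x \<Rightarrow>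
     (real \<Rightarrow> 'a) set \<Rightarrow> (nat \<Rightarrow> 'x) set" where
  "boundary_projection \<mu> Y H b \<xi> =
     (THE \<eta>. \<eta> \<in> gromov_boundary (hspace H (htop H)) b \<and>
        (\<forall>h\<in>\<xi>. (\<exists>D. median_ray Y \<mu> D h) \<longrightarrow>
           (\<forall>\<gamma>. (\<forall>t\<ge>0. \<gamma> t \<in> hproj H (htop H) (h t)) \<longrightarrow>
              defines_boundary_point (hspace H (htop H)) b 0 \<gamma> \<eta>)))"

definition projection_topology ::
  "'a metric \<Rightarrow> 'a \<Rightarrow> (real \<Rightarrow> real) \<Rightarrow> ('a \<Rightarrow> 'a \<Rightarrow> 'a \<Rightarrow> 'a) \<Rightarrow> ('a, 'i, 'x, 'z) hhs_scheme \<Rightarrow> 'x \<Rightarrow>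
     (real \<Rightarrow> 'a) set topology" where
  "projection_topology Y p \<kappa> \<mu> H b =
     pullback_topology (kappa_boundary Y p \<kappa>) (boundary_projection \<mu> Y H b)
       (visual_topology (hspace H (htop H)) b)"

end

theory Submission
  imports Defs
begin

text \<open>
  In \<open>\<C>(S)\<close> the distance from \<open>\<pi>\<^sub>S(p)\<close> to the projection of \<open>\<mu>(p, x, y)\<close> is, up to a constant, the
  Gromov product of the projections of \<open>x\<close> and \<open>y\<close>.  As \<open>\<pi>\<^sub>S\<close> is coarsely Lipschitz, large Gromov
  products force the median far from \<open>p\<close> in the group.  Conversely, if \<open>y = h(t)\<close> for a median ray
  \<open>h\<close> whose projection is unbounded, then a median whose projection stays near \<open>\<pi>\<^sub>S(p)\<close> stays near
  \<open>p\<close>: by the bounded geodesic image axiom and the uniqueness axiom it coarsely lies between \<open>p\<close> and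
  an initial point \<open>h(u)\<close>.  So convergence in the median sense and convergence of Gromov products at
  infinity agree.  The same fact shows that sublinearly close median rays have the same endpoint in
  \<open>\<partial>\<C>(S)\<close>, so that the boundary map is well defined.
\<close>

section \<open>Coarse betweenness\<close>

text \<open>The obstacle is that a median can be far from \<open>p\<close> in the group because of
  proper domains alone, leaving no trace in \<open>\<C>(S)\<close>, so no comparison can be expected
  for arbitrary pairs of points. An asymmetry of the convergence helps: the ray \<open>h\<close> of
  the limit stays fixed, and the bound found in \<open>median_bounded\<close> depends on
  \<open>h\<close> and on the radius, but not on the other point \<open>x\<close>. The rays of the
  sequence may therefore vary freely. To keep the estimates linear, geodesics are replaced by
  \<open>coarsely_between\<close>, and a proper domain \<open>V\<close> is seen in
  \<open>\<C>(S)\<close> only through one point \<open>\<rho> V\<close>. On the topological side,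
  median-open sets are defined by sequences; integer radii suffice for the visual neighbourhoods, so
  a failure of visual openness is always witnessed by a sequence.\<close>

lemma set_dist_le:
  assumes "a \<in> A" "b \<in> B"
  shows "set_dist X A B \<le> mdist X a b"
proof -
  have "bdd_below ((\<lambda>p. mdist X (fst p) (snd p)) ` (A \<times> B))"
    by (rule bdd_belowI[of _ 0]) auto
  from cINF_lower[OF this, of "(a, b)"] assms show ?thesis
    unfolding set_dist_def by simp
qed

text \<open>The infimum need not be attained, hence the strict bound. Later estimates pay for it
  with an extra summand 1.\<close>

lemma set_dist_less_imp:
  assumes "set_dist X A B < r" "A \<noteq> {}" "B \<noteq> {}"
  obtains a b where "a \<in> A" "b \<in> B" "mdist X a b < r"
proof -
  have "bdd_below ((\<lambda>p. mdist X (fst p) (snd p)) ` (A \<times> B))"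
    by (rule bdd_belowI[of _ 0]) auto
  moreover have "A \<times> B \<noteq> {}" using assms by auto
  ultimately have "\<exists>p\<in>A \<times> B. mdist X (fst p) (snd p) < r"
    using assms(1) unfolding set_dist_def by (simp add: cINF_less_iff)
  then show thesis using that by auto
qed

lemma mdiam_le_iff: "mdiam X A \<le> ereal r \<longleftrightarrow> (\<forall>a\<in>A. \<forall>b\<in>A. mdist X a b \<le> r)"
  unfolding mdiam_def by (auto simp: SUP_le_iff)

text \<open>This bounds twice the Gromov product of \<open>a\<close> and \<open>b\<close> based at
  \<open>m\<close> by \<open>c\<close>. The additive form makes sense without geodesics and combines
  by linear arithmetic.\<close>

definition coarsely_between :: "'a metric \<Rightarrow> real \<Rightarrow> 'a \<Rightarrow> 'a \<Rightarrow> 'a \<Rightarrow> bool" where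
  "coarsely_between X c a m b \<longleftrightarrow> mdist X a m + mdist X m b \<le> mdist X a b + c"

lemma coarsely_between_mono:
  "coarsely_between X c a m b \<Longrightarrow> c \<le> c' \<Longrightarrow> coarsely_between X c' a m b"
  by (simp add: coarsely_between_def)

text \<open>Each of the three distances changes by at most \<open>2 * r\<close>.\<close>

lemma coarsely_between_perturb:
  assumes "coarsely_between X c a m b"
    and "mdist X a a' \<le> r" "mdist X m m' \<le> r" "mdist X b b' \<le> r"
    and "{a, a', b, b', m, m'} \<subseteq> mspace X"
  shows "coarsely_between X (c + 6 * r) a' m' b'"
proof -
  have "mdist X a' m' \<le> mdist X a' a + mdist X a m + mdist X m m'"
    using assms(5) mdist_triangle[of a' X a m'] mdist_triangle[of a X m m'] by simp
  moreover have "mdist X m' b' \<le> mdist X m' m + mdist X m b + mdist X b b'"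
    using assms(5) mdist_triangle[of m' X m b'] mdist_triangle[of m X b b'] by simp
  moreover have "mdist X a b \<le> mdist X a a' + mdist X a' b' + mdist X b' b"
    using assms(5) mdist_triangle[of a X a' b] mdist_triangle[of a' X b' b] by simp
  ultimately show ?thesis
    using assms(1-4) unfolding coarsely_between_def by (simp add: mdist_commute)
qed

lemma coarsely_between_near_geodesic:
  assumes "is_geodesic X P a b" "q \<in> mspace X" "set_dist X {q} P < r"
  shows "coarsely_between X (2 * r) a q b"
proof -
  obtain L \<gamma> where L: "0 \<le> L" "\<gamma> \<in> {0..L} \<rightarrow> mspace X" "\<gamma> 0 = a" "\<gamma> L = b"
    "\<And>s t. s \<in> {0..L} \<Longrightarrow> t \<in> {0..L} \<Longrightarrow> mdist X (\<gamma> s) (\<gamma> t) = \<bar>s - t\<bar>" "P = \<gamma> ` {0..L}"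
    using assms(1) unfolding is_geodesic_def by blast
  from L have "P \<noteq> {}" by auto
  then obtain x where x: "x \<in> P" "mdist X q x < r"
    using set_dist_less_imp[OF assms(3)] by auto
  then obtain t where t: "t \<in> {0..L}" "x = \<gamma> t" using L by auto
  have X: "a \<in> mspace X" "b \<in> mspace X" "x \<in> mspace X" using L t by (auto simp: Pi_iff)
  have "mdist X a x + mdist X x b = mdist X a b"
    using L(5)[of 0 t] L(5)[of t L] L(5)[of 0 L] L(1,3,4) t by auto
  moreover have "mdist X a q \<le> mdist X a x + mdist X x q" "mdist X q b \<le> mdist X q x + mdist X x b"
    using X assms(2) by (auto intro: mdist_triangle)
  ultimately show ?thesis using x(2) unfolding coarsely_between_def by (simp add: mdist_commute)
qed

lemma is_geodesic_endpoints:
  assumes "is_geodesic X P a b"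
  shows "a \<in> P" "b \<in> P" "P \<subseteq> mspace X"
  using assms unfolding is_geodesic_def by (auto simp: Pi_iff)


section \<open>Coarse rays in hyperbolic spaces\<close>

locale gromov_hyperbolic =
  fixes X :: "'x metric" and \<delta> :: real and b :: 'x
  assumes hyp: "hyperbolic \<delta> X" and base: "b \<in> mspace X"
begin

abbreviation GP :: "'x \<Rightarrow> 'x \<Rightarrow> real" where "GP \<equiv> gromov_product X b"

lemma delta_nonneg: "0 \<le> \<delta>"
  using hyp base unfolding hyperbolic_def gromov_product_def by fastforce

lemma GP_commute: "GP x y = GP y x"
  by (simp add: gromov_product_def mdist_commute)

lemma GP_self: "x \<in> mspace X \<Longrightarrow> GP x x = mdist X b x"
  by (simp add: gromov_product_def)

lemma GP_le:
  assumes "x \<in> mspace X" "y \<in> mspace X"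
  shows "GP x y \<le> mdist X b x"
  using mdist_triangle[OF base assms(1,2)] by (simp add: gromov_product_def)

lemma GP_le':
  assumes "x \<in> mspace X" "y \<in> mspace X"
  shows "GP x y \<le> mdist X b y"
  using GP_le[OF assms(2,1)] GP_commute by simp

lemma GP_ultra:
  assumes "x \<in> mspace X" "y \<in> mspace X" "z \<in> mspace X"
  shows "min (GP x z) (GP z y) - \<delta> \<le> GP x y"
  using hyp base assms unfolding hyperbolic_def by auto

lemma GP_ultra3:
  assumes "x \<in> mspace X" "y \<in> mspace X" "u \<in> mspace X" "v \<in> mspace X"
  shows "min (GP x u) (min (GP u v) (GP v y)) - 2 * \<delta> \<le> GP x y"
  using GP_ultra[OF assms(1,2,3)] GP_ultra[OF assms(3,2,4)] delta_nonneg by linarith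

section \<open>The Gromov boundary as a quotient and its boundary product\<close>

definition asymptotic :: "((nat \<Rightarrow> 'x) \<times> (nat \<Rightarrow> 'x)) set" where
  "asymptotic = {(x, y). x \<in> seqs_to_infinity X b \<and> y \<in> seqs_to_infinity X b \<and>
                filterlim (\<lambda>i. GP (x i) (y i)) at_top sequentially}"

lemma gromov_boundary_eq: "gromov_boundary X b = seqs_to_infinity X b // asymptotic"
  by (simp add: gromov_boundary_def asymptotic_def)

lemma seqs_in_space: "x \<in> seqs_to_infinity X b \<Longrightarrow> x i \<in> mspace X"
  by (auto simp: seqs_to_infinity_def)

lemma equiv_asymptotic: "equiv (seqs_to_infinity X b) asymptotic"
proof (rule equivI)
  show "asymptotic \<subseteq> seqs_to_infinity X b \<times> seqs_to_infinity X b"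
    by (auto simp: asymptotic_def)
  show "refl_on (seqs_to_infinity X b) asymptotic"
  proof (rule refl_onI)
    fix x assume x: "x \<in> seqs_to_infinity X b"
    then have "filterlim (\<lambda>(i, j). GP (x i) (x j)) at_top (sequentially \<times>\<^sub>F sequentially)"
      by (simp add: seqs_to_infinity_def)
    \<comment> \<open>Reflexivity: the double limit is restricted to the diagonal.\<close>
    from filterlim_compose[OF this filterlim_Pair[OF filterlim_ident filterlim_ident]]
    show "(x, x) \<in> asymptotic" using x by (simp add: asymptotic_def)
  qed
  show "sym asymptotic"
    by (rule symI) (auto simp: asymptotic_def GP_commute)
  show "trans asymptotic"
  proof (rule transI)
    fix x y z assume xy: "(x, y) \<in> asymptotic" and yz: "(y, z) \<in> asymptotic"
    then have s: "x \<in> seqs_to_infinity X b" "y \<in> seqs_to_infinity X b" "z \<in> seqs_to_infinity X b"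
      by (auto simp: asymptotic_def)
    have "filterlim (\<lambda>i. GP (x i) (z i)) at_top sequentially"
      unfolding filterlim_at_top
    proof
      fix R
      have "\<forall>\<^sub>F i in sequentially. R + \<delta> \<le> GP (x i) (y i)" "\<forall>\<^sub>F i in sequentially. R + \<delta> \<le> GP (y i) (z i)"
        using xy yz by (auto simp: asymptotic_def filterlim_at_top)
      then show "\<forall>\<^sub>F i in sequentially. R \<le> GP (x i) (z i)"
      proof eventually_elim
        case (elim i)
        with GP_ultra[of "x i" "z i" "y i"] s seqs_in_space show ?case by fastforce
      qed
    qed
    with s show "(x, z) \<in> asymptotic" by (simp add: asymptotic_def)
  qed
qed

lemma boundary_in_seqs: "\<eta> \<in> gromov_boundary X b \<Longrightarrow> x \<in> \<eta> \<Longrightarrow> x \<in> seqs_to_infinity X b"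
  using in_quotient_imp_subset[OF equiv_asymptotic] by (auto simp: gromov_boundary_eq)

lemma boundary_nonempty: "\<eta> \<in> gromov_boundary X b \<Longrightarrow> \<eta> \<noteq> {}"
  using in_quotient_imp_non_empty[OF equiv_asymptotic] by (auto simp: gromov_boundary_eq)

lemma boundary_asymptotic:
  "\<eta> \<in> gromov_boundary X b \<Longrightarrow> x \<in> \<eta> \<Longrightarrow> y \<in> \<eta> \<Longrightarrow> (x, y) \<in> asymptotic"
  using in_quotient_imp_in_rel[OF equiv_asymptotic] by (auto simp: gromov_boundary_eq)

lemma boundary_eqI:
  assumes "\<eta> \<in> gromov_boundary X b" "\<eta>' \<in> gromov_boundary X b" "x \<in> \<eta>" "x \<in> \<eta>'"
  shows "\<eta> = \<eta>'"
  using assms quotient_eqI[OF equiv_asymptotic, of \<eta> \<eta>' x x] boundary_asymptotic[OF assms(1,3,3)]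
  by (simp add: gromov_boundary_eq)

lemma boundary_product_lessD:
  assumes "ereal R < boundary_product X b \<xi> \<eta>" "x \<in> \<xi>" "y \<in> \<eta>"
  shows "\<forall>\<^sub>F i in sequentially. R < GP (x i) (y i)"
proof -
  have "boundary_product X b \<xi> \<eta> \<le> liminf (\<lambda>i. ereal (GP (x i) (y i)))"
    unfolding boundary_product_def using assms(2,3) by (meson INF_lower2 INF_lower)
  with assms(1) have "ereal R < liminf (\<lambda>i. ereal (GP (x i) (y i)))" by order
  from less_LiminfD[OF this] show ?thesis by simp
qed

text \<open>A liminf yields only a weak inequality; the strict bounds derived from this lemma aim at
  \<open>R + 1\<close> first.\<close>

lemma le_boundary_productI:
  assumes "\<And>x y. x \<in> \<xi> \<Longrightarrow> y \<in> \<eta> \<Longrightarrow> \<forall>\<^sub>F i in sequentially. R \<le> GP (x i) (y i)"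
  shows "ereal R \<le> boundary_product X b \<xi> \<eta>"
  unfolding boundary_product_def
  by (intro INF_greatest Liminf_bounded) (use assms in auto)

lemma boundary_product_self:
  assumes "\<eta> \<in> gromov_boundary X b"
  shows "ereal R < boundary_product X b \<eta> \<eta>"
proof -
  have "ereal (R + 1) \<le> boundary_product X b \<eta> \<eta>"
    using boundary_asymptotic[OF assms]
    by (intro le_boundary_productI) (auto simp: asymptotic_def filterlim_at_top)
  then show ?thesis by (rule less_le_trans[rotated]) simp
qed

text \<open>One \<open>\<delta>\<close> is lost to hyperbolicity and 1 to strictness. It serves to
  show that a set defined by product balls is open at each of its points.\<close>

lemma boundary_product_ultra:
  assumes bd: "\<xi> \<in> gromov_boundary X b" "\<zeta> \<in> gromov_boundary X b" "\<eta> \<in> gromov_boundary X b"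
    and "ereal (R + \<delta> + 1) < boundary_product X b \<xi> \<zeta>"
    and "ereal (R + \<delta> + 1) < boundary_product X b \<zeta> \<eta>"
  shows "ereal R < boundary_product X b \<xi> \<eta>"
proof -
  have "ereal (R + 1) \<le> boundary_product X b \<xi> \<eta>"
  proof (rule le_boundary_productI)
    fix x y assume x: "x \<in> \<xi>" and y: "y \<in> \<eta>"
    obtain z where z: "z \<in> \<zeta>" using boundary_nonempty[OF bd(2)] by auto
    from boundary_product_lessD[OF assms(4) x z] boundary_product_lessD[OF assms(5) z y]
    show "\<forall>\<^sub>F i in sequentially. R + 1 \<le> GP (x i) (y i)"
    proof eventually_elim
      case (elim i)
      have "x i \<in> mspace X" "y i \<in> mspace X" "z i \<in> mspace X"
        using bd x y z boundary_in_seqs seqs_in_space by blast+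
      from GP_ultra[OF this] elim show ?case by linarith
    qed
  qed
  then show ?thesis by (rule less_le_trans[rotated]) simp
qed

text \<open>Equivalently, \<open>\<gamma> s\<close> lies between \<open>b\<close> and
  \<open>\<gamma> t\<close> up to \<open>2 * c\<close>. No speed is prescribed, because the
  projection of a ray to \<open>\<C>(S)\<close> may stand still for a long time.\<close>

definition coarse_ray :: "real \<Rightarrow> (real \<Rightarrow> 'x) \<Rightarrow> bool" where
  "coarse_ray c \<gamma> \<longleftrightarrow> (\<forall>t\<ge>0. \<gamma> t \<in> mspace X) \<and>
     (\<forall>s\<ge>0. \<forall>t\<ge>s. mdist X b (\<gamma> s) - c \<le> GP (\<gamma> s) (\<gamma> t))"

lemma coarse_ray_mono: "coarse_ray c \<gamma> \<Longrightarrow> c \<le> c' \<Longrightarrow> coarse_ray c' \<gamma>"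
  unfolding coarse_ray_def by (meson diff_left_mono order_trans)

text \<open>A product never exceeds the distance from \<open>b\<close> to either entry. So in the
  chain from \<open>\<gamma> s'\<close> via \<open>\<gamma> s\<close> and \<open>\<gamma>' t\<close>
  to \<open>\<gamma>' t'\<close> the middle product is, up to \<open>c\<close>, the smallest of the
  three.\<close>

lemma coarse_ray_GP_mono:
  assumes "coarse_ray c \<gamma>" "coarse_ray c \<gamma>'" "0 \<le> c" "0 \<le> s" "s \<le> s'" "0 \<le> t" "t \<le> t'"
  shows "GP (\<gamma> s) (\<gamma>' t) - c - 2 * \<delta> \<le> GP (\<gamma> s') (\<gamma>' t')"
proof -
  have X: "\<gamma> s \<in> mspace X" "\<gamma> s' \<in> mspace X" "\<gamma>' t \<in> mspace X" "\<gamma>' t' \<in> mspace X"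
    using assms by (auto simp: coarse_ray_def)
  have "mdist X b (\<gamma> s) - c \<le> GP (\<gamma> s') (\<gamma> s)" "mdist X b (\<gamma>' t) - c \<le> GP (\<gamma>' t) (\<gamma>' t')"
    using assms by (auto simp: coarse_ray_def GP_commute)
  with GP_ultra3[of "\<gamma> s'" "\<gamma>' t'" "\<gamma> s" "\<gamma>' t"] GP_le[of "\<gamma> s" "\<gamma>' t"] GP_le'[of "\<gamma> s" "\<gamma>' t"] X \<open>0 \<le> c\<close>
  show ?thesis by linarith
qed

text \<open>For coarse rays a single large product persists at all later parameters, so this
  existential form already says that both rays run to the same point at infinity. With both
  arguments equal it says that the ray is unbounded.\<close>

definition joint_end :: "(real \<Rightarrow> 'x) \<Rightarrow> (real \<Rightarrow> 'x) \<Rightarrow> bool" where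
  "joint_end \<gamma> \<gamma>' \<longleftrightarrow> (\<forall>R. \<exists>s\<ge>0. \<exists>t\<ge>0. R < GP (\<gamma> s) (\<gamma>' t))"

text \<open>The filter is arbitrary so that the double limit in \<open>seqs_to_infinity\<close> and
  the single limit in \<open>asymptotic\<close> are both instances.\<close>

lemma joint_end_GP_at_top:
  assumes "joint_end \<gamma> \<gamma>'" "coarse_ray c \<gamma>" "coarse_ray c \<gamma>'" "0 \<le> c"
    and f: "filterlim f at_top F" and g: "filterlim g at_top F"
  shows "filterlim (\<lambda>i. GP (\<gamma> (f i)) (\<gamma>' (g i))) at_top F"
  unfolding filterlim_at_top
proof
  fix R
  obtain s t where st: "s \<ge> 0" "t \<ge> 0" "R + c + 2 * \<delta> < GP (\<gamma> s) (\<gamma>' t)"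
    using assms(1) unfolding joint_end_def by blast
  have "\<forall>\<^sub>F i in F. s \<le> f i" "\<forall>\<^sub>F i in F. t \<le> g i"
    using f g by (auto simp: filterlim_at_top)
  then show "\<forall>\<^sub>F i in F. R \<le> GP (\<gamma> (f i)) (\<gamma>' (g i))"
  proof eventually_elim
    case (elim i)
    from coarse_ray_GP_mono[OF assms(2-4) st(1) elim(1) st(2) elim(2)] st(3) show ?case by linarith
  qed
qed

lemma joint_end_self_left:
  assumes "joint_end \<gamma> \<gamma>'" "coarse_ray c \<gamma>" "coarse_ray c \<gamma>'"
  shows "joint_end \<gamma> \<gamma>"
  unfolding joint_end_def
proof
  fix R
  obtain s t where st: "s \<ge> 0" "t \<ge> 0" "R < GP (\<gamma> s) (\<gamma>' t)"
    using assms(1) unfolding joint_end_def by blast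
  have X: "\<gamma> s \<in> mspace X" "\<gamma>' t \<in> mspace X" using assms st by (auto simp: coarse_ray_def)
  with GP_le[OF X] st GP_self[OF X(1)] show "\<exists>s\<ge>0. \<exists>t\<ge>0. R < GP (\<gamma> s) (\<gamma> t)"
    by (intro exI[of _ s] conjI) auto
qed

lemma joint_end_commute: "joint_end \<gamma> \<gamma>' \<Longrightarrow> joint_end \<gamma>' \<gamma>"
  unfolding joint_end_def using GP_commute by metis

lemma coarse_ray_seqs_to_infinity:
  assumes "joint_end \<gamma> \<gamma>" "coarse_ray c \<gamma>" "0 \<le> c"
    and t: "filterlim t at_top sequentially" "\<And>i. 0 \<le> t i"
  shows "(\<lambda>i. \<gamma> (t i)) \<in> seqs_to_infinity X b"
proof -
  have "filterlim (\<lambda>p. GP (\<gamma> (t (fst p))) (\<gamma> (t (snd p)))) at_top (sequentially \<times>\<^sub>F sequentially)"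
    by (intro joint_end_GP_at_top[OF assms(1,2,2,3)] filterlim_compose[OF t(1)] filterlim_fst filterlim_snd)
  then show ?thesis
    using assms(2) t(2) by (auto simp: seqs_to_infinity_def coarse_ray_def split_beta')
qed

definition endpoint :: "(real \<Rightarrow> 'x) \<Rightarrow> (nat \<Rightarrow> 'x) set" where
  "endpoint \<gamma> = asymptotic `` {\<lambda>i. \<gamma> (real i)}"

lemma endpoint_in_boundary:
  assumes "joint_end \<gamma> \<gamma>" "coarse_ray c \<gamma>" "0 \<le> c"
  shows "endpoint \<gamma> \<in> gromov_boundary X b"
  unfolding endpoint_def gromov_boundary_eq
  by (intro quotientI coarse_ray_seqs_to_infinity[OF assms] filterlim_real_sequentially) auto

text \<open>Allowing a second ray \<open>\<gamma>'\<close> yields at once that the endpoint does not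
  depend on the ray that represents it.\<close>

lemma joint_end_defines:
  assumes "joint_end \<gamma> \<gamma>'" "coarse_ray c \<gamma>" "coarse_ray c \<gamma>'" "0 \<le> c"
  shows "defines_boundary_point X b 0 \<gamma>' (endpoint \<gamma>)"
proof -
  have 1: "joint_end \<gamma> \<gamma>" by (rule joint_end_self_left[OF assms(1-3)])
  have 2: "joint_end \<gamma>' \<gamma>'"
    by (rule joint_end_self_left[OF joint_end_commute[OF assms(1)] assms(3,2)])
  show ?thesis
    unfolding defines_boundary_point_def
  proof (intro conjI allI impI)
    show "endpoint \<gamma> \<in> gromov_boundary X b" by (rule endpoint_in_boundary[OF 1 assms(2,4)])
    fix t :: "nat \<Rightarrow> real" assume t: "incseq t \<and> (\<forall>i. 0 \<le> t i) \<and> filterlim t at_top sequentially"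
    then have "(\<lambda>i. \<gamma>' (t i)) \<in> seqs_to_infinity X b"
      by (intro coarse_ray_seqs_to_infinity[OF 2 assms(3,4)]) auto
    moreover have "(\<lambda>i. \<gamma> (real i)) \<in> seqs_to_infinity X b"
      by (intro coarse_ray_seqs_to_infinity[OF 1 assms(2,4)] filterlim_real_sequentially) auto
    moreover have "filterlim (\<lambda>i. GP (\<gamma> (real i)) (\<gamma>' (t i))) at_top sequentially"
      using t by (intro joint_end_GP_at_top[OF assms] filterlim_real_sequentially) auto
    ultimately show "(\<lambda>i. \<gamma>' (t i)) \<in> endpoint \<gamma>"
      unfolding endpoint_def asymptotic_def by simp
  qed
qed

lemma defines_boundary_point_reals:
  assumes "defines_boundary_point X b 0 \<gamma> \<eta>"
  shows "(\<lambda>i. \<gamma> (real i)) \<in> \<eta>"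
  using assms filterlim_real_sequentially
  unfolding defines_boundary_point_def by (simp add: incseq_def)

lemma defines_boundary_point_unique:
  assumes "defines_boundary_point X b 0 \<gamma> \<eta>" "defines_boundary_point X b 0 \<gamma> \<eta>'"
  shows "\<eta> = \<eta>'"
  using boundary_eqI[of \<eta> \<eta>'] assms defines_boundary_point_reals
  by (auto simp: defines_boundary_point_def)

lemma boundary_product_imp_GP:
  assumes "defines_boundary_point X b 0 \<gamma> \<xi>" "defines_boundary_point X b 0 \<gamma>' \<eta>"
    and "ereal R < boundary_product X b \<xi> \<eta>"
  obtains s t where "0 \<le> s" "0 \<le> t" "R < GP (\<gamma> s) (\<gamma>' t)"
proof -
  from boundary_product_lessD[OF assms(3) assms(1,2)[THEN defines_boundary_point_reals]]
  obtain i where "R < GP (\<gamma> (real i)) (\<gamma>' (real i))"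
    by (auto simp: eventually_sequentially)
  then show thesis by (intro that[of "real i" "real i"]) auto
qed

text \<open>Passing to late integer times costs \<open>c + 2 * \<delta>\<close>; passing from there
  to arbitrary representatives \<open>x\<close> and \<open>y\<close> costs another
  \<open>2 * \<delta>\<close>.\<close>

lemma GP_imp_boundary_product:
  assumes "defines_boundary_point X b 0 \<gamma> \<xi>" "defines_boundary_point X b 0 \<gamma>' \<eta>"
    and ray: "coarse_ray c \<gamma>" "coarse_ray c \<gamma>'" "0 \<le> c"
    and st: "0 \<le> s" "0 \<le> t" "R + c + 4 * \<delta> < GP (\<gamma> s) (\<gamma>' t)"
  shows "ereal R \<le> boundary_product X b \<xi> \<eta>"
proof (rule le_boundary_productI)
  fix x y assume x: "x \<in> \<xi>" and y: "y \<in> \<eta>"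
  have "(x, \<lambda>i. \<gamma> (real i)) \<in> asymptotic" "(\<lambda>i. \<gamma>' (real i), y) \<in> asymptotic"
    using x y assms(1,2)[THEN defines_boundary_point_reals] boundary_asymptotic assms(1,2)
    by (auto simp: defines_boundary_point_def)
  then have near: "\<forall>\<^sub>F i in sequentially. R + 2 * \<delta> \<le> GP (x i) (\<gamma> (real i))"
      "\<forall>\<^sub>F i in sequentially. R + 2 * \<delta> \<le> GP (\<gamma>' (real i)) (y i)"
    and s: "x \<in> seqs_to_infinity X b" "y \<in> seqs_to_infinity X b"
    by (auto simp: asymptotic_def filterlim_at_top)
  have "\<forall>\<^sub>F i in sequentially. s \<le> real i" "\<forall>\<^sub>F i in sequentially. t \<le> real i"
    using filterlim_real_sequentially by (auto simp: filterlim_at_top)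
  with near show "\<forall>\<^sub>F i in sequentially. R \<le> GP (x i) (y i)"
  proof eventually_elim
    case (elim i)
    have "x i \<in> mspace X" "y i \<in> mspace X" "\<gamma> (real i) \<in> mspace X" "\<gamma>' (real i) \<in> mspace X"
      using s seqs_in_space ray by (auto simp: coarse_ray_def)
    from GP_ultra3[OF this] coarse_ray_GP_mono[OF ray st(1) elim(3) st(2) elim(4)] st(3) elim
    show ?case by linarith
  qed
qed

end


section \<open>Sublinear tracking\<close>

text \<open>Closeness up to every linear slope, instead of up to a multiple of
  \<open>\<kappa>\<close>. In this form the relation composes by the triangle inequality alone,
  whatever the growth of \<open>\<kappa>\<close>.\<close>

definition sublinearly_tracks :: "'a metric \<Rightarrow> 'a \<Rightarrow> (real \<Rightarrow> 'a) \<Rightarrow> (real \<Rightarrow> 'a) \<Rightarrow> bool" where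
  "sublinearly_tracks Y p h h' \<longleftrightarrow>
     (\<forall>\<epsilon>>0. \<exists>C. \<forall>s\<ge>0. \<exists>t\<ge>0. mdist Y (h s) (h' t) \<le> \<epsilon> * mdist Y p (h s) + C)"

lemma sublinearly_tracks_trans:
  assumes "sublinearly_tracks Y p h k" "sublinearly_tracks Y p k l"
    and "p \<in> mspace Y" "h \<in> {0..} \<rightarrow> mspace Y" "k \<in> {0..} \<rightarrow> mspace Y" "l \<in> {0..} \<rightarrow> mspace Y"
  shows "sublinearly_tracks Y p h l"
  unfolding sublinearly_tracks_def
proof (intro allI impI)
  fix \<epsilon> :: real assume "\<epsilon> > 0"
  \<comment> \<open>As \<open>e \<le> 1\<close>, the point of \<open>k\<close> has distance at most
    twice that of \<open>h s\<close> plus \<open>C\<close> from \<open>p\<close>; the two errors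
    then have total slope \<open>3 * e\<close>.\<close>
  define e where "e = min 1 (\<epsilon> / 3)"
  have e: "e > 0" "e \<le> 1" "3 * e \<le> \<epsilon>" using \<open>\<epsilon> > 0\<close> by (auto simp: e_def)
  obtain C where C: "\<And>s. s \<ge> 0 \<Longrightarrow> \<exists>t\<ge>0. mdist Y (h s) (k t) \<le> e * mdist Y p (h s) + C"
    using assms(1) e(1) unfolding sublinearly_tracks_def by blast
  obtain C' where C': "\<And>s. s \<ge> 0 \<Longrightarrow> \<exists>t\<ge>0. mdist Y (k s) (l t) \<le> e * mdist Y p (k s) + C'"
    using assms(2) e(1) unfolding sublinearly_tracks_def by blast
  show "\<exists>C. \<forall>s\<ge>0. \<exists>t\<ge>0. mdist Y (h s) (l t) \<le> \<epsilon> * mdist Y p (h s) + C"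
  proof (rule exI[of _ "C + e * C + C'"], intro allI impI)
    fix s :: real assume s: "s \<ge> 0"
    obtain t where t: "t \<ge> 0" "mdist Y (h s) (k t) \<le> e * mdist Y p (h s) + C" using C[OF s] by auto
    obtain u where u: "u \<ge> 0" "mdist Y (k t) (l u) \<le> e * mdist Y p (k t) + C'" using C'[OF t(1)] by auto
    have Y: "h s \<in> mspace Y" "k t \<in> mspace Y" "l u \<in> mspace Y" using assms(4-6) s t u by auto
    let ?a = "mdist Y p (h s)"
    have "e * ?a \<le> 1 * ?a" using e by (intro mult_right_mono) auto
    then have "mdist Y p (k t) \<le> 2 * ?a + C"
      using mdist_triangle[OF assms(3) Y(1,2)] t(2) by linarith
    then have "e * mdist Y p (k t) \<le> e * (2 * ?a + C)" using e by (intro mult_left_mono) auto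
    then have "mdist Y (h s) (l u) \<le> 3 * e * ?a + (C + e * C + C')"
      using mdist_triangle[OF Y] t(2) u(2) by (simp add: algebra_simps)
    also have "3 * e * ?a \<le> \<epsilon> * ?a" using e by (intro mult_right_mono) auto
    finally show "\<exists>t\<ge>0. mdist Y (h s) (l t) \<le> \<epsilon> * ?a + (C + e * C + C')" using u(1) by auto
  qed
qed

lemma sublinear_fun_affine_bound:
  assumes "sublinear_fun \<kappa>" "0 < e"
  obtains C where "0 \<le> C" "\<And>a. 0 \<le> a \<Longrightarrow> \<kappa> a \<le> e * a + C"
proof -
  have "((\<lambda>t. \<kappa> t / t) \<longlongrightarrow> 0) at_top" using assms(1) by (simp add: sublinear_fun_def)
  then have "\<forall>\<^sub>F t in at_top. \<kappa> t / t < e" by (rule order_tendstoD) (rule assms(2))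
  then obtain T where T: "\<And>t. T \<le> t \<Longrightarrow> \<kappa> t / t < e" by (auto simp: eventually_at_top_linorder)
  \<comment> \<open>The lower bound 1 makes \<open>a\<close> positive when
    \<open>T' \<le> a\<close>, so the quotient can be cleared.\<close>
  define T' where "T' = max T 1"
  show thesis
  proof
    show "0 \<le> \<kappa> T'" using assms(1) by (auto simp: sublinear_fun_def T'_def)
    fix a :: real assume a: "0 \<le> a"
    show "\<kappa> a \<le> e * a + \<kappa> T'"
    proof (cases "T' \<le> a")
      case True
      then have "\<kappa> a / a < e" "0 < a" using T[of a] by (auto simp: T'_def)
      then have "\<kappa> a \<le> e * a" by (simp add: field_simps)
      with \<open>0 \<le> \<kappa> T'\<close> show ?thesis by linarith
    next
      case False
      moreover have "mono_on {0..} \<kappa>" using assms(1) by (simp add: sublinear_fun_def)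
      ultimately have "\<kappa> a \<le> \<kappa> T'" using a by (intro mono_onD[of "{0..}" \<kappa>]) auto
      moreover have "0 \<le> e * a" using assms(2) a by simp
      ultimately show ?thesis by linarith
    qed
  qed
qed

lemma kappa_nbhd_sublinearly_tracks:
  assumes "sublinear_fun \<kappa>" "0 \<le> n" "h ` {0..} \<subseteq> kappa_nbhd Y p \<kappa> (h' ` {0..}) n"
  shows "sublinearly_tracks Y p h h'"
  unfolding sublinearly_tracks_def
proof (intro allI impI)
  fix \<epsilon> :: real assume "\<epsilon> > 0"
  \<comment> \<open>Multiplying by \<open>n\<close> afterwards must leave a slope of at most
    \<open>\<epsilon>\<close>, also when \<open>n\<close> is 0.\<close>
  then have "\<epsilon> / (n + 1) > 0" using assms(2) by simp
  from sublinear_fun_affine_bound[OF assms(1) this]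
  obtain C where C: "0 \<le> C" "\<And>a. 0 \<le> a \<Longrightarrow> \<kappa> a \<le> \<epsilon> / (n + 1) * a + C" by blast
  show "\<exists>C. \<forall>s\<ge>0. \<exists>t\<ge>0. mdist Y (h s) (h' t) \<le> \<epsilon> * mdist Y p (h s) + C"
  proof (rule exI[of _ "n * C + 1"], intro allI impI)
    fix s :: real assume s: "s \<ge> 0"
    let ?a = "mdist Y p (h s)"
    have "set_dist Y {h s} (h' ` {0..}) \<le> n * \<kappa> ?a"
      using assms(3) s by (auto simp: kappa_nbhd_def)
    then have "set_dist Y {h s} (h' ` {0..}) < n * \<kappa> ?a + 1" by simp
    from set_dist_less_imp[OF this] obtain t where t: "t \<ge> 0" "mdist Y (h s) (h' t) < n * \<kappa> ?a + 1"
      by auto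
    have "n * \<kappa> ?a \<le> n * (\<epsilon> / (n + 1) * ?a + C)" using C(2)[of ?a] assms(2) by (intro mult_left_mono) auto
    moreover have "n * (\<epsilon> / (n + 1) * ?a) \<le> \<epsilon> * ?a"
      using assms(2) \<open>\<epsilon> > 0\<close> by (simp add: field_simps)
    ultimately have "n * \<kappa> ?a \<le> \<epsilon> * ?a + n * C" by (simp add: distrib_left)
    with t show "\<exists>t\<ge>0. mdist Y (h s) (h' t) \<le> \<epsilon> * ?a + (n * C + 1)" by (intro exI[of _ t]) auto
  qed
qed

lemma kappa_Morse_rays_in_space: "h \<in> kappa_Morse_rays Y p \<kappa> \<Longrightarrow> h \<in> {0..} \<rightarrow> mspace Y"
  by (auto simp: kappa_Morse_rays_def quasi_geodesic_def)

text \<open>A boundary point is the set of rays fellow travelling with one ray \<open>k\<close>.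
  Both rays are compared with \<open>k\<close>, and tracking composes.\<close>

lemma kappa_boundary_sublinearly_tracks:
  assumes "sublinear_fun \<kappa>" "p \<in> mspace Y" "\<xi> \<in> kappa_boundary Y p \<kappa>" "h \<in> \<xi>" "h' \<in> \<xi>"
  shows "sublinearly_tracks Y p h h'"
proof -
  obtain k where "\<xi> = {(h, h'). h \<in> kappa_Morse_rays Y p \<kappa> \<and> h' \<in> kappa_Morse_rays Y p \<kappa> \<and>
                 kappa_fellow_travel Y p \<kappa> h h'} `` {k}"
    using assms(3) unfolding kappa_boundary_def by (elim quotientE)
  with assms(4,5) have k: "k \<in> kappa_Morse_rays Y p \<kappa>" "h \<in> kappa_Morse_rays Y p \<kappa>"
    "h' \<in> kappa_Morse_rays Y p \<kappa>" "kappa_fellow_travel Y p \<kappa> k h" "kappa_fellow_travel Y p \<kappa> k h'"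
    by simp_all
  have "sublinearly_tracks Y p h k" "sublinearly_tracks Y p k h'"
    using k(4,5) unfolding kappa_fellow_travel_def
    by (auto elim: kappa_nbhd_sublinearly_tracks[OF assms(1), rotated])
  from sublinearly_tracks_trans[OF this assms(2)] show ?thesis
    using k(1-3)[THEN kappa_Morse_rays_in_space] by blast
qed


section \<open>Median rays and their projections\<close>

text \<open>
  The hierarchical structure enters only through points \<open>q W x\<close> of \<open>\<pi>\<^sub>W(x)\<close>, points \<open>\<rho> V\<close> of
  \<open>\<rho>\<^sup>V\<^sub>S\<close>, and a single constant \<open>c\<close>.  The assumption \<open>passes_by\<close> combines consistency with the
  bounded geodesic image axiom.
\<close>

locale median_projections = gromov_hyperbolic "hspace H (htop H)" \<delta> b
  for H :: "('a, 'i, 'x, 'z) hhs_scheme" and \<delta> :: real and b :: 'x +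
  fixes Y :: "'a metric" and \<mu> :: "'a \<Rightarrow> 'a \<Rightarrow> 'a \<Rightarrow> 'a" and p :: 'a
    and q :: "'i \<Rightarrow> 'a \<Rightarrow> 'x" and \<rho> :: "'i \<Rightarrow> 'x" and c :: real and \<theta> :: "real \<Rightarrow> real"
  assumes c_nonneg: "0 \<le> c"
    and p_in: "p \<in> mspace Y"
    and top_in: "htop H \<in> hindex H"
    and q_in: "\<And>W x. W \<in> hindex H \<Longrightarrow> x \<in> mspace Y \<Longrightarrow> q W x \<in> mspace (hspace H W)"
    and q_hproj: "\<And>x. x \<in> mspace Y \<Longrightarrow> q (htop H) x \<in> hproj H (htop H) x"
    and hproj_near: "\<And>x a. x \<in> mspace Y \<Longrightarrow> a \<in> hproj H (htop H) x \<Longrightarrow>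
          a \<in> mspace (hspace H (htop H)) \<and> mdist (hspace H (htop H)) (q (htop H) x) a \<le> c"
    and q_Lipschitz: "\<And>W x y. W \<in> hindex H \<Longrightarrow> x \<in> mspace Y \<Longrightarrow> y \<in> mspace Y \<Longrightarrow>
          mdist (hspace H W) (q W x) (q W y) \<le> c * mdist Y x y + c"
    and mu_in: "\<And>x y z. x \<in> mspace Y \<Longrightarrow> y \<in> mspace Y \<Longrightarrow> z \<in> mspace Y \<Longrightarrow> \<mu> x y z \<in> mspace Y"
    and mu_idem: "\<And>x y. x \<in> mspace Y \<Longrightarrow> y \<in> mspace Y \<Longrightarrow> \<mu> x x y = x"
    and mu_swap: "\<And>x y z. x \<in> mspace Y \<Longrightarrow> y \<in> mspace Y \<Longrightarrow> z \<in> mspace Y \<Longrightarrow>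
          \<mu> x y z = \<mu> y x z \<and> \<mu> x y z = \<mu> x z y"
    and mu_Lipschitz: "\<And>x x' y z. x \<in> mspace Y \<Longrightarrow> x' \<in> mspace Y \<Longrightarrow> y \<in> mspace Y \<Longrightarrow> z \<in> mspace Y \<Longrightarrow>
          mdist Y (\<mu> x y z) (\<mu> x' y z) \<le> c * mdist Y x x' + c"
    and mu_between: "\<And>W x y z. W \<in> hindex H \<Longrightarrow> x \<in> mspace Y \<Longrightarrow> y \<in> mspace Y \<Longrightarrow> z \<in> mspace Y \<Longrightarrow>
          coarsely_between (hspace H W) c (q W x) (q W (\<mu> x y z)) (q W y)"
    and rho_in: "\<And>V. V \<in> hindex H \<Longrightarrow> V \<noteq> htop H \<Longrightarrow> \<rho> V \<in> mspace (hspace H (htop H))"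
    and passes_by: "\<And>V x y. V \<in> hindex H \<Longrightarrow> V \<noteq> htop H \<Longrightarrow> x \<in> mspace Y \<Longrightarrow> y \<in> mspace Y \<Longrightarrow>
          c < mdist (hspace H V) (q V x) (q V y) \<Longrightarrow>
          coarsely_between (hspace H (htop H)) c (q (htop H) x) (\<rho> V) (q (htop H) y)"
    and uniqueness: "\<And>x y k. x \<in> mspace Y \<Longrightarrow> y \<in> mspace Y \<Longrightarrow>
          (\<And>W. W \<in> hindex H \<Longrightarrow> mdist (hspace H W) (q W x) (q W y) \<le> k) \<Longrightarrow> mdist Y x y \<le> \<theta> k"
begin

abbreviation X :: "'x metric" where "X \<equiv> hspace H (htop H)"

abbreviation \<pi> :: "'a \<Rightarrow> 'x" where "\<pi> \<equiv> q (htop H)"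

lemma pi_in: "x \<in> mspace Y \<Longrightarrow> \<pi> x \<in> mspace X"
  by (rule q_in[OF top_in])

section \<open>Betweenness for medians and median rays in every domain\<close>

lemma mu_between_13:
  assumes "W \<in> hindex H" "x \<in> mspace Y" "y \<in> mspace Y" "z \<in> mspace Y"
  shows "coarsely_between (hspace H W) c (q W x) (q W (\<mu> x y z)) (q W z)"
  using mu_between[OF assms(1,2,4,3)] mu_swap[OF assms(2-4)] by metis

lemma mu_between_23:
  assumes "W \<in> hindex H" "x \<in> mspace Y" "y \<in> mspace Y" "z \<in> mspace Y"
  shows "coarsely_between (hspace H W) c (q W y) (q W (\<mu> x y z)) (q W z)"
  using mu_between_13[OF assms(1,3,2,4)] mu_swap[OF assms(2-4)] by metis

text \<open>Since \<open>\<mu> x y x = x\<close>, this is the effect of moving the third entry from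
  \<open>x\<close> to \<open>z\<close>.\<close>

lemma mu_bound:
  assumes "x \<in> mspace Y" "y \<in> mspace Y" "z \<in> mspace Y"
  shows "mdist Y x (\<mu> x y z) \<le> c * mdist Y x z + c"
proof -
  have "\<mu> x y x = x" using mu_swap mu_idem assms by metis
  moreover have "\<mu> x y z = \<mu> z y x" using mu_swap assms by metis
  ultimately show ?thesis using mu_Lipschitz[of x z y x] assms by simp
qed

lemma median_ray_in: "median_ray Y \<mu> D h \<Longrightarrow> 0 \<le> t \<Longrightarrow> h t \<in> mspace Y"
  by (auto simp: median_ray_def quasi_geodesic_def)

lemma median_ray_ge_1: "median_ray Y \<mu> D h \<Longrightarrow> 1 \<le> D"
  by (simp add: median_ray_def quasi_geodesic_def)

lemma median_ray_dist:
  assumes "median_ray Y \<mu> D h" "0 \<le> t"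
  shows "t / D - D \<le> mdist Y (h 0) (h t)" "mdist Y (h 0) (h t) \<le> D * t + D"
proof -
  have "\<bar>0 - t\<bar> / D - D \<le> mdist Y (h 0) (h t) \<and> mdist Y (h 0) (h t) \<le> D * \<bar>0 - t\<bar> + D"
    using assms unfolding median_ray_def quasi_geodesic_def by (metis atLeast_iff order_refl)
  with assms(2) show "t / D - D \<le> mdist Y (h 0) (h t)" "mdist Y (h 0) (h t) \<le> D * t + D"
    by simp_all
qed

text \<open>The real median of \<open>0\<close>, \<open>s\<close>, \<open>t\<close> is
  \<open>s\<close>, so \<open>h s\<close> is within \<open>D\<close> of a group median and, in each
  domain, within \<open>c * D + c\<close> of its projection. The constant is the same for all
  domains.\<close>

lemma median_ray_between:
  assumes h: "median_ray Y \<mu> D h" and st: "0 \<le> s" "s \<le> t" and W: "W \<in> hindex H"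
  shows "coarsely_between (hspace H W) (c + 6 * (c * D + c)) (q W (h 0)) (q W (h s)) (q W (h t))"
proof -
  have Y: "h 0 \<in> mspace Y" "h s \<in> mspace Y" "h t \<in> mspace Y"
    using median_ray_in[OF h] st by auto
  let ?m = "\<mu> (h 0) (h s) (h t)"
  have m: "?m \<in> mspace Y" using mu_in Y by blast
  have "real_median 0 s t = s" using st by (simp add: real_median_def)
  moreover have "mdist Y (h (real_median 0 s t)) ?m \<le> D"
    using h st unfolding median_ray_def by simp
  ultimately have "mdist Y (h s) ?m \<le> D" by simp
  then have "c * mdist Y (h s) ?m + c \<le> c * D + c" using c_nonneg by (simp add: mult_left_mono)
  then have "mdist (hspace H W) (q W ?m) (q W (h s)) \<le> c * D + c"
    using q_Lipschitz[OF W Y(2) m] by (simp add: mdist_commute)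
  moreover have "mdist (hspace H W) (q W x) (q W x) \<le> c * D + c" if "x \<in> mspace Y" for x
    proof -
    have "mdist (hspace H W) (q W x) (q W x) = 0" using q_in[OF W that] by simp
    moreover have "0 \<le> c * D" using c_nonneg median_ray_ge_1[OF h] by simp
    ultimately show ?thesis using c_nonneg by linarith
  qed
  ultimately show ?thesis
    using q_in[OF W] Y m by (intro coarsely_between_perturb[OF mu_between_13[OF W Y]]) auto
qed

text \<open>Here \<open>x\<close> is the start of the ray. The distance from \<open>b\<close> and
  one \<open>c\<close> pay for measuring from \<open>b\<close> instead of from the projected start;
  the rest generously covers betweenness for points chosen within \<open>c\<close> of
  \<open>\<pi>\<close>.\<close>

definition ray_const :: "real \<Rightarrow> 'a \<Rightarrow> real" where
  "ray_const D x = mdist X b (\<pi> x) + 8 * c + 6 * (c * D + c)"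

lemma ray_const_nonneg: "0 \<le> D \<Longrightarrow> 0 \<le> ray_const D x"
  using c_nonneg by (simp add: ray_const_def)

text \<open>Arbitrary selections \<open>\<gamma>\<close> are treated because
  \<open>boundary_projection\<close> quantifies over all of them.\<close>

lemma median_ray_coarse_ray:
  assumes h: "median_ray Y \<mu> D h" and \<gamma>: "\<And>t. 0 \<le> t \<Longrightarrow> \<gamma> t \<in> hproj H (htop H) (h t)"
  shows "coarse_ray (ray_const D (h 0)) \<gamma>"
  unfolding coarse_ray_def
proof (intro conjI allI impI)
  have near: "\<gamma> t \<in> mspace X" "mdist X (\<pi> (h t)) (\<gamma> t) \<le> c" if "0 \<le> t" for t
    using hproj_near median_ray_in[OF h that] \<gamma>[OF that] by auto
  show "\<gamma> t \<in> mspace X" if "0 \<le> t" for t using near that by simp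
  fix s t :: real assume st: "0 \<le> s" "s \<le> t"
  have Y: "h 0 \<in> mspace Y" "h s \<in> mspace Y" "h t \<in> mspace Y"
    using median_ray_in[OF h] st by auto
  have X: "\<gamma> 0 \<in> mspace X" "\<gamma> s \<in> mspace X" "\<gamma> t \<in> mspace X" using near st by auto
  have "coarsely_between X (c + 6 * (c * D + c) + 6 * c) (\<gamma> 0) (\<gamma> s) (\<gamma> t)"
    using near[of 0] near[of s] near[of t] st pi_in Y
    by (intro coarsely_between_perturb[OF median_ray_between[OF h st top_in]]) auto
  moreover have "mdist X b (\<gamma> 0) \<le> mdist X b (\<pi> (h 0)) + c"
    using mdist_triangle[OF base pi_in[OF Y(1)] X(1)] near(2)[of 0] by simp
  moreover have "mdist X b (\<gamma> s) \<le> mdist X b (\<gamma> 0) + mdist X (\<gamma> 0) (\<gamma> s)"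
      "mdist X (\<gamma> 0) (\<gamma> t) \<le> mdist X b (\<gamma> 0) + mdist X b (\<gamma> t)"
    using mdist_triangle[OF base X(1,2)] mdist_triangle[OF X(1) base X(3)]
    by (simp_all add: mdist_commute)
  moreover have "0 \<le> c * D" using c_nonneg median_ray_ge_1[OF h] by simp
  ultimately show "mdist X b (\<gamma> s) - ray_const D (h 0) \<le> GP (\<gamma> s) (\<gamma> t)"
    using c_nonneg unfolding gromov_product_def ray_const_def coarsely_between_def
    by (simp add: field_simps)
qed

section \<open>Gromov products in \<open>\<C>(S)\<close> against medians in the group\<close>

definition median_const :: real where "median_const = mdist X b (\<pi> p) + c"

text \<open>Betweenness along the three sides gives the product based at \<open>\<pi> p\<close> up
  to \<open>c\<close>; moving the base point to \<open>b\<close> costs their distance.\<close>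

lemma GP_median:
  assumes "x \<in> mspace Y" "y \<in> mspace Y"
  shows "\<bar>GP (\<pi> x) (\<pi> y) - mdist X (\<pi> p) (\<pi> (\<mu> p x y))\<bar> \<le> median_const"
proof -
  let ?m = "\<pi> (\<mu> p x y)"
  have Y: "\<pi> p \<in> mspace X" "\<pi> x \<in> mspace X" "\<pi> y \<in> mspace X" "?m \<in> mspace X"
    using p_in assms mu_in pi_in by auto
  have "coarsely_between X c (\<pi> p) ?m (\<pi> x)" "coarsely_between X c (\<pi> p) ?m (\<pi> y)"
      "coarsely_between X c (\<pi> x) ?m (\<pi> y)"
    using mu_between mu_between_13 mu_between_23 top_in p_in assms by blast+
  moreover have "mdist X (\<pi> p) (\<pi> x) \<le> mdist X (\<pi> p) ?m + mdist X ?m (\<pi> x)"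
      "mdist X (\<pi> p) (\<pi> y) \<le> mdist X (\<pi> p) ?m + mdist X ?m (\<pi> y)"
      "mdist X (\<pi> x) (\<pi> y) \<le> mdist X (\<pi> x) ?m + mdist X ?m (\<pi> y)"
      "mdist X b (\<pi> x) \<le> mdist X b (\<pi> p) + mdist X (\<pi> p) (\<pi> x)"
      "mdist X b (\<pi> y) \<le> mdist X b (\<pi> p) + mdist X (\<pi> p) (\<pi> y)"
      "mdist X (\<pi> p) (\<pi> x) \<le> mdist X (\<pi> p) b + mdist X b (\<pi> x)"
      "mdist X (\<pi> p) (\<pi> y) \<le> mdist X (\<pi> p) b + mdist X b (\<pi> y)"
    using Y base by (auto intro: mdist_triangle)
  moreover have "mdist X (\<pi> p) b = mdist X b (\<pi> p)" "mdist X ?m (\<pi> x) = mdist X (\<pi> x) ?m"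
    by (auto simp: mdist_commute)
  ultimately show ?thesis
    using c_nonneg unfolding gromov_product_def median_const_def coarsely_between_def
    by (intro abs_leI) (simp_all add: field_simps)
qed

lemma good_ray_unbounded:
  assumes "h \<in> good_rays Y p \<mu> H D"
  obtains u where "0 \<le> u" "R < mdist X (\<pi> p) (\<pi> (h u))"
proof -
  have h: "median_ray Y \<mu> D h" "mdiam X (\<Union>t\<in>{0..}. hproj H (htop H) (h t)) = \<infinity>"
    using assms by (auto simp: good_rays_def)
  have "\<exists>u\<ge>0. R < mdist X (\<pi> p) (\<pi> (h u))"
  proof (rule ccontr)
    assume *: "\<not> ?thesis"
    have near: "a \<in> mspace X \<and> mdist X (\<pi> p) a \<le> R + c"
      if "0 \<le> t" "a \<in> hproj H (htop H) (h t)" for a t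
    proof -
      have Y: "h t \<in> mspace Y" using median_ray_in[OF h(1)] that by simp
      have "mdist X (\<pi> p) (\<pi> (h t)) \<le> R" using * that by (auto simp: not_less)
      with mdist_triangle[OF pi_in[OF p_in] pi_in[OF Y], of a] hproj_near[OF Y that(2)]
      show ?thesis by auto
    qed
    have "mdiam X (\<Union>t\<in>{0..}. hproj H (htop H) (h t)) \<le> ereal (2 * (R + c))"
      unfolding mdiam_le_iff
    proof (intro ballI)
      fix a a' assume "a \<in> (\<Union>t\<in>{0..}. hproj H (htop H) (h t))" "a' \<in> (\<Union>t\<in>{0..}. hproj H (htop H) (h t))"
      then have "a \<in> mspace X \<and> mdist X (\<pi> p) a \<le> R + c" "a' \<in> mspace X \<and> mdist X (\<pi> p) a' \<le> R + c"
        using near by auto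
      with mdist_triangle[of a X "\<pi> p" a'] pi_in[OF p_in] show "mdist X a a' \<le> 2 * (R + c)"
        by (simp add: mdist_commute)
    qed
    with h(2) show False by simp
  qed
  then show thesis using that by auto
qed

text \<open>
  Choose \<open>u\<close> with \<open>\<pi>\<^sub>S(h(u))\<close> much further than \<open>R\<close> from \<open>\<pi>\<^sub>S(p)\<close>.  A
  domain in which \<open>h\<close> makes progress beyond \<open>h(u)\<close> projects to \<open>\<C>(S)\<close> beyond \<open>\<pi>\<^sub>S(h(u))\<close>, so a
  median of \<open>p\<close>, \<open>x\<close>, \<open>h(t)\<close> with projection \<open>R\<close>-close to \<open>\<pi>\<^sub>S(p)\<close> has made no progress there.
  Hence in every domain it coarsely lies between \<open>p\<close> and \<open>h(u)\<close>, where \<open>u\<close> depends only on \<open>R\<close>.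
\<close>

lemma median_bounded:
  assumes good: "h \<in> good_rays Y p \<mu> H D"
  obtains M where "\<And>x t. x \<in> mspace Y \<Longrightarrow> 0 \<le> t \<Longrightarrow>
     mdist X (\<pi> p) (\<pi> (\<mu> p x (h t))) \<le> R \<Longrightarrow> mdist Y p (\<mu> p x (h t)) \<le> M"
proof -
  have h: "median_ray Y \<mu> D h" "h 0 = p" using good by (auto simp: good_rays_def)
  define c' where "c' = c + 6 * (c * D + c)"
  have c': "c \<le> c'" using c_nonneg median_ray_ge_1[OF h(1)] by (simp add: c'_def)
  \<comment> \<open>If a domain saw progress both before the median and beyond \<open>h u\<close>,
    its \<open>\<rho>\<close> would be within \<open>R + c\<close> of \<open>\<pi> p\<close> and
    also coarsely beyond \<open>h u\<close>. That would force \<open>h u\<close> to be at most this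
    far away.\<close>
  obtain u where u: "0 \<le> u" "R + 2 * c + c' < mdist X (\<pi> p) (\<pi> (h u))"
    using good_ray_unbounded[OF good] by blast
  let ?z = "h u"
  have z: "?z \<in> mspace Y" using median_ray_in[OF h(1) u(1)] .
  define k where "k = 4 * c + 2 * \<delta>"
  \<comment> \<open>The first entry covers \<open>t \<le> u\<close>, where \<open>h t\<close> itself
    is bounded. The second covers \<open>t > u\<close>: there \<open>k\<close> bounds the distance
    between the two medians below in every domain.\<close>
  define M where "M = max (c * (D * u + D) + c) (\<theta> k + c * mdist Y p ?z + c)"
  show thesis
  proof (rule that[of M])
    fix x t assume x: "x \<in> mspace Y" and t: "0 \<le> t" and R: "mdist X (\<pi> p) (\<pi> (\<mu> p x (h t))) \<le> R"
    let ?y = "h t" and ?m = "\<mu> p x (h t)"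
    \<comment> \<open>As \<open>h u\<close> is fixed, \<open>?m'\<close> is near \<open>p\<close> by
      \<open>mu_bound\<close>; it remains to compare \<open>?m\<close> with \<open>?m'\<close> by
      uniqueness.\<close>
    let ?m' = "\<mu> p ?m ?z"
    have y: "?y \<in> mspace Y" using median_ray_in[OF h(1) t] .
    have m: "?m \<in> mspace Y" "?m' \<in> mspace Y" using mu_in p_in x y z by auto
    show "mdist Y p ?m \<le> M"
    proof (cases "t \<le> u")
      case True
      have "mdist Y (h 0) (h t) \<le> D * t + D" by (rule median_ray_dist(2)[OF h(1) t])
      also have "\<dots> \<le> D * u + D"
        using True t median_ray_ge_1[OF h(1)] by (simp add: mult_left_mono)
      finally have "c * mdist Y p ?y + c \<le> c * (D * u + D) + c"
        using c_nonneg h(2) by (simp add: mult_left_mono)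
      then show ?thesis using mu_bound[OF p_in x y] unfolding M_def by linarith
    next
      case False
      have zy: "coarsely_between (hspace H V) c' (q V p) (q V ?z) (q V ?y)" if "V \<in> hindex H" for V
        using median_ray_between[OF h(1) u(1) _ that, of t] False h(2) by (simp add: c'_def)
      have my: "coarsely_between (hspace H V) c (q V p) (q V ?m) (q V ?y)" if "V \<in> hindex H" for V
        using mu_between_13[OF that p_in x y] .
      have mz: "coarsely_between (hspace H V) (3 * c + 2 * \<delta>) (q V p) (q V ?m) (q V ?z)"
        if V: "V \<in> hindex H" for V
      proof (cases "V = htop H")
        case True
        \<comment> \<open>Based at \<open>\<pi> p\<close>, both products with
          \<open>\<pi> ?y\<close> are at least the distance of the median minus \<open>c\<close>;
          for \<open>\<pi> ?z\<close> this holds because it is further away than \<open>R\<close>.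
          Hyperbolicity then removes \<open>\<pi> ?y\<close>.\<close>
        let ?g = "gromov_product X (\<pi> p)"
        have "min (?g (\<pi> ?m) (\<pi> ?y)) (?g (\<pi> ?y) (\<pi> ?z)) - \<delta> \<le> ?g (\<pi> ?m) (\<pi> ?z)"
          using hyp pi_in p_in m y z unfolding hyperbolic_def by blast
        moreover have "mdist X (\<pi> p) (\<pi> ?m) - c \<le> ?g (\<pi> ?m) (\<pi> ?y)"
          using my[OF top_in] c_nonneg
          unfolding gromov_product_def coarsely_between_def by (simp add: field_simps)
        moreover have "mdist X (\<pi> p) (\<pi> ?m) - c \<le> ?g (\<pi> ?y) (\<pi> ?z)"
          using zy[OF top_in] R u(2) c_nonneg c' mdist_commute[of X "\<pi> ?y" "\<pi> ?z"]
          unfolding gromov_product_def coarsely_between_def by (simp add: field_simps)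
        ultimately have "mdist X (\<pi> p) (\<pi> ?m) - c - \<delta> \<le> ?g (\<pi> ?m) (\<pi> ?z)" by linarith
        then show ?thesis
          using c_nonneg unfolding True gromov_product_def coarsely_between_def by (simp add: field_simps)
      next
        case False
        have XV: "q V p \<in> mspace (hspace H V)" "q V ?m \<in> mspace (hspace H V)"
            "q V ?z \<in> mspace (hspace H V)" "q V ?y \<in> mspace (hspace H V)"
          using q_in[OF V] p_in m y z by auto
        consider "mdist (hspace H V) (q V ?z) (q V ?y) \<le> c" | "mdist (hspace H V) (q V p) (q V ?m) \<le> c"
          | "c < mdist (hspace H V) (q V ?z) (q V ?y)" "c < mdist (hspace H V) (q V p) (q V ?m)"
          by linarith
        then show ?thesis
        proof cases
          case 1
          then show ?thesis
            using my[OF V] mdist_triangle[OF XV(2,4,3)] mdist_triangle[OF XV(1,3,4)] delta_nonneg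
              mdist_commute[of "hspace H V" "q V ?y" "q V ?z"]
            unfolding coarsely_between_def by linarith
        next
          case 2
          then show ?thesis
            using mdist_triangle[OF XV(2,1,3)] delta_nonneg c_nonneg
              mdist_commute[of "hspace H V" "q V p" "q V ?m"]
            unfolding coarsely_between_def by linarith
        next
          case 3
          have "coarsely_between X c (\<pi> ?z) (\<rho> V) (\<pi> ?y)" "coarsely_between X c (\<pi> p) (\<rho> V) (\<pi> ?m)"
            using passes_by[OF V False] 3 p_in m y z by blast+
          then have "mdist X (\<pi> p) (\<pi> ?z) \<le> R + 2 * c + c'"
            using R zy[OF top_in] mdist_triangle[OF pi_in[OF p_in] rho_in[OF V False] pi_in[OF y]]
              mdist_nonneg[of X "\<pi> ?z" "\<rho> V"] mdist_nonneg[of X "\<rho> V" "\<pi> ?m"]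
            unfolding coarsely_between_def by linarith
          with u(2) show ?thesis by simp
        qed
      qed
      have "mdist Y ?m ?m' \<le> \<theta> k"
      proof (rule uniqueness[OF m])
        fix V assume V: "V \<in> hindex H"
        have XV: "q V p \<in> mspace (hspace H V)" "q V ?m' \<in> mspace (hspace H V)"
            "q V ?z \<in> mspace (hspace H V)"
          using q_in[OF V] p_in m z by auto
        show "mdist (hspace H V) (q V ?m) (q V ?m') \<le> k"
          using mu_between[OF V p_in m(1) z] mu_between_23[OF V p_in m(1) z] mz[OF V] delta_nonneg c_nonneg
            mdist_triangle[OF XV] mdist_commute[of "hspace H V" "q V ?m'" "q V ?m"]
          unfolding coarsely_between_def k_def by linarith
      qed
      then show ?thesis
        using mu_bound[OF p_in m(1) z] mdist_triangle[OF p_in m(2,1)] mdist_commute[of Y ?m ?m']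
        unfolding M_def by linarith
    qed
  qed
qed

text \<open>If the products were bounded, so would be all medians of \<open>p\<close>,
  \<open>h s\<close>, \<open>k t\<close>. But for \<open>k t\<close> close to \<open>h s\<close> the
  median is close to \<open>k t\<close>, up to a small fraction of the distance from
  \<open>p\<close>. Then \<open>h\<close> would be bounded, contrary to being
  quasi-geodesic.\<close>

lemma sublinearly_tracks_joint_end:
  assumes good: "k \<in> good_rays Y p \<mu> H D" and h: "median_ray Y \<mu> D' h"
    and tracks: "sublinearly_tracks Y p h k"
    and \<gamma>: "\<And>t. 0 \<le> t \<Longrightarrow> \<gamma> t \<in> hproj H (htop H) (h t)"
  shows "joint_end \<gamma> (\<lambda>t. \<pi> (k t))"
  unfolding joint_end_def
proof (rule allI, rule ccontr)
  fix R assume *: "\<not> (\<exists>s\<ge>0. \<exists>t\<ge>0. R < GP (\<gamma> s) (\<pi> (k t)))"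
  have k: "median_ray Y \<mu> D k" using good by (simp add: good_rays_def)
  obtain M where M: "\<And>x t. x \<in> mspace Y \<Longrightarrow> 0 \<le> t \<Longrightarrow>
     mdist X (\<pi> p) (\<pi> (\<mu> p x (k t))) \<le> R + c + median_const \<Longrightarrow> mdist Y p (\<mu> p x (k t)) \<le> M"
    using median_bounded[OF good] by blast
  have overlap: "mdist Y p (\<mu> p (h s) (k t)) \<le> M" if st: "0 \<le> s" "0 \<le> t" for s t
  proof -
    have Y: "h s \<in> mspace Y" "k t \<in> mspace Y" using median_ray_in h k st by auto
    have \<gamma>s: "\<gamma> s \<in> mspace X" "mdist X (\<pi> (h s)) (\<gamma> s) \<le> c" using hproj_near[OF Y(1) \<gamma>[OF st(1)]] by auto
    have "GP (\<pi> (h s)) (\<pi> (k t)) \<le> GP (\<gamma> s) (\<pi> (k t)) + c"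
      using mdist_triangle[OF base \<gamma>s(1) pi_in[OF Y(1)]] \<gamma>s(2) mdist_commute[of X "\<gamma> s" "\<pi> (h s)"]
        mdist_triangle[OF \<gamma>s(1) pi_in[OF Y(1)] pi_in[OF Y(2)]]
      unfolding gromov_product_def by (simp add: field_simps)
    moreover have "GP (\<gamma> s) (\<pi> (k t)) \<le> R" using * st by (auto simp: not_less)
    ultimately have "mdist X (\<pi> p) (\<pi> (\<mu> p (h s) (k t))) \<le> R + c + median_const"
      using GP_median[OF Y] by linarith
    then show ?thesis by (rule M[OF Y(1) st(2)])
  qed
  \<comment> \<open>The tracking error enters \<open>c\<close> times through the median and once
    directly. With total slope one half it can be absorbed on the left.\<close>
  define e where "e = 1 / (2 * (c + 1))"
  have e: "e > 0" "(c + 1) * e = 1 / 2" using c_nonneg by (auto simp: e_def)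
  obtain C where C: "\<And>s. s \<ge> 0 \<Longrightarrow> \<exists>t\<ge>0. mdist Y (h s) (k t) \<le> e * mdist Y p (h s) + C"
    using tracks e(1) unfolding sublinearly_tracks_def by blast
  have bound: "mdist Y p (h s) \<le> 2 * (M + (c + 1) * C + c)" if s: "0 \<le> s" for s
  proof -
    obtain t where t: "0 \<le> t" "mdist Y (h s) (k t) \<le> e * mdist Y p (h s) + C" using C[OF s] by auto
    have Y: "h s \<in> mspace Y" "k t \<in> mspace Y" using median_ray_in h k s t by auto
    have m: "\<mu> p (h s) (k t) \<in> mspace Y" using mu_in p_in Y by blast
    have "\<mu> (k t) p (k t) = k t" using mu_swap[OF Y(2) p_in Y(2)] mu_idem[OF Y(2) p_in] by metis
    moreover have "\<mu> p (h s) (k t) = \<mu> (h s) p (k t)" using mu_swap[OF p_in Y] by simp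
    ultimately have "mdist Y (\<mu> p (h s) (k t)) (k t) \<le> c * mdist Y (h s) (k t) + c"
      using mu_Lipschitz[OF Y p_in Y(2)] by simp
    with overlap[OF s t(1)] mdist_triangle[OF p_in m Y(2)]
      mdist_triangle[OF p_in Y(2,1)] mdist_commute[of Y "k t" "h s"]
    have "mdist Y p (h s) \<le> M + (c + 1) * mdist Y (h s) (k t) + c" by (simp add: algebra_simps)
    also have "(c + 1) * mdist Y (h s) (k t) \<le> (c + 1) * (e * mdist Y p (h s) + C)"
      using t(2) c_nonneg by (intro mult_left_mono) auto
    also have "\<dots> = ((c + 1) * e) * mdist Y p (h s) + (c + 1) * C" by (simp add: algebra_simps)
    also have "\<dots> = mdist Y p (h s) / 2 + (c + 1) * C" unfolding e(2) by simp
    finally show ?thesis by simp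
  qed
  define B where "B = mdist Y p (h 0) + 2 * (M + (c + 1) * C + c) + D'"
  have D': "1 \<le> D'" by (rule median_ray_ge_1[OF h])
  have "0 \<le> B" using bound[of 0] D' mdist_nonneg[of Y p "h 0"] unfolding B_def by linarith
  \<comment> \<open>The lower quasi-geodesic bound at this time is \<open>B + 1 - D'\<close>, just
    beyond what \<open>bound\<close> allows. The ray \<open>h\<close> need not start at
    \<open>p\<close>, hence the first summand of \<open>B\<close>.\<close>
  define s where "s = D' * (B + 1)"
  have s: "0 \<le> s" using D' \<open>0 \<le> B\<close> by (simp add: s_def)
  have "B + 1 - D' \<le> mdist Y (h 0) (h s)" using median_ray_dist(1)[OF h s] D' by (simp add: s_def)
  with mdist_triangle[OF median_ray_in[OF h order_refl] p_in median_ray_in[OF h s]] bound[OF s] s mdist_commute[of Y p "h 0"]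
  show False unfolding B_def by linarith
qed


subsection \<open>Comparison of the topologies\<close>

lemma pi_selects: "median_ray Y \<mu> D h \<Longrightarrow> 0 \<le> t \<Longrightarrow> \<pi> (h t) \<in> hproj H (htop H) (h t)"
  using q_hproj median_ray_in by blast

text \<open>The description in \<open>boundary_projection\<close> wants one point for all median
  rays in \<open>\<xi>\<close>, with any constant, and all selections. Each such ray tracks
  \<open>h\<close>, so the endpoint of \<open>h\<close> serves; it is unique because
  \<open>h\<close> is itself one of these rays.\<close>

lemma good_ray_defines:
  assumes "sublinear_fun \<kappa>" "\<xi> \<in> kappa_boundary Y p \<kappa>" "h \<in> \<xi>" and good: "h \<in> good_rays Y p \<mu> H D"
  shows "defines_boundary_point X b 0 (\<lambda>t. \<pi> (h t)) (boundary_projection \<mu> Y H b \<xi>)"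
proof -
  have h: "median_ray Y \<mu> D h" using good by (simp add: good_rays_def)
  let ?\<eta> = "endpoint (\<lambda>t. \<pi> (h t))"
  have def: "defines_boundary_point X b 0 \<gamma> ?\<eta>"
    if k: "k \<in> \<xi>" "median_ray Y \<mu> D' k" and \<gamma>: "\<And>t. 0 \<le> t \<Longrightarrow> \<gamma> t \<in> hproj H (htop H) (k t)"
    for k D' \<gamma>
  proof -
    have "sublinearly_tracks Y p k h"
      using kappa_boundary_sublinearly_tracks[OF assms(1) p_in assms(2) k(1) assms(3)] .
    then have "joint_end \<gamma> (\<lambda>t. \<pi> (h t))"
      using \<gamma> by (rule sublinearly_tracks_joint_end[OF good k(2)])
    then have 1: "joint_end (\<lambda>t. \<pi> (h t)) \<gamma>" by (rule joint_end_commute)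
    let ?C = "max (ray_const D (h 0)) (ray_const D' (k 0))"
    have "coarse_ray ?C (\<lambda>t. \<pi> (h t))" "coarse_ray ?C \<gamma>"
      by (rule coarse_ray_mono[OF median_ray_coarse_ray[OF h pi_selects[OF h]]], simp_all)
        (rule coarse_ray_mono[OF median_ray_coarse_ray[OF k(2) \<gamma>]], simp_all)
    moreover have "0 \<le> ?C" using ray_const_nonneg[of D "h 0"] median_ray_ge_1[OF h] by simp
    ultimately show ?thesis by (rule joint_end_defines[OF 1])
  qed
  have self: "defines_boundary_point X b 0 (\<lambda>t. \<pi> (h t)) ?\<eta>"
    by (rule def[OF assms(3) h pi_selects[OF h]])
  have "boundary_projection \<mu> Y H b \<xi> = ?\<eta>"
    unfolding boundary_projection_def
  proof (rule the_equality)
    show "?\<eta> \<in> gromov_boundary X b \<and> (\<forall>h\<in>\<xi>. (\<exists>D. median_ray Y \<mu> D h) \<longrightarrow>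
           (\<forall>\<gamma>. (\<forall>t\<ge>0. \<gamma> t \<in> hproj H (htop H) (h t)) \<longrightarrow> defines_boundary_point X b 0 \<gamma> ?\<eta>))"
      using def self by (auto simp: defines_boundary_point_def[of _ _ _ "\<lambda>t. \<pi> (h t)"])
  next
    fix \<eta> assume \<eta>: "\<eta> \<in> gromov_boundary X b \<and> (\<forall>h\<in>\<xi>. (\<exists>D. median_ray Y \<mu> D h) \<longrightarrow>
           (\<forall>\<gamma>. (\<forall>t\<ge>0. \<gamma> t \<in> hproj H (htop H) (h t)) \<longrightarrow> defines_boundary_point X b 0 \<gamma> \<eta>))"
    have "\<forall>t\<ge>0. \<pi> (h t) \<in> hproj H (htop H) (h t)" using pi_selects[OF h] by simp
    then have "defines_boundary_point X b 0 (\<lambda>t. \<pi> (h t)) \<eta>"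
      using \<eta> assms(3) h by auto
    then show "\<eta> = ?\<eta>" using self by (rule defines_boundary_point_unique)
  qed
  with self show ?thesis by simp
qed

lemma good_ray_coarse_ray:
  assumes "h \<in> good_rays Y p \<mu> H D"
  shows "coarse_ray (ray_const D p) (\<lambda>t. \<pi> (h t))" "0 \<le> ray_const D p"
proof -
  have h: "median_ray Y \<mu> D h" "h 0 = p" using assms by (auto simp: good_rays_def)
  show "coarse_ray (ray_const D p) (\<lambda>t. \<pi> (h t))"
    using median_ray_coarse_ray[OF h(1) pi_selects[OF h(1)]] h(2) by simp
  show "0 \<le> ray_const D p" using ray_const_nonneg median_ray_ge_1[OF h(1)] by simp
qed

text \<open>This is \<open>median_bounded\<close> read contrapositively for the fixed ray
  \<open>h\<close>: an overlap beyond \<open>M\<close> forces a large product in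
  \<open>\<C>(S)\<close>.\<close>

lemma median_converges_imp_boundary_product:
  assumes sub: "sublinear_fun \<kappa>" and reps: "\<And>\<xi>. \<xi> \<in> kappa_boundary Y p \<kappa> \<Longrightarrow> \<xi> \<inter> good_rays Y p \<mu> H D \<noteq> {}"
    and \<xi>: "\<xi> \<in> kappa_boundary Y p \<kappa>" and \<Xi>: "range \<Xi> \<subseteq> kappa_boundary Y p \<kappa>"
    and conv: "median_converges Y p \<mu> H D \<Xi> \<xi>"
  shows "\<forall>\<^sub>F n in sequentially. ereal R <
           boundary_product X b (boundary_projection \<mu> Y H b \<xi>) (boundary_projection \<mu> Y H b (\<Xi> n))"
proof -
  obtain h where h: "h \<in> \<xi>" "h \<in> good_rays Y p \<mu> H D" using reps[OF \<xi>] by auto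
  have "\<forall>n. \<exists>k. k \<in> \<Xi> n \<inter> good_rays Y p \<mu> H D" using reps \<Xi> by blast
  then obtain k where k: "\<And>n. k n \<in> \<Xi> n" "\<And>n. k n \<in> good_rays Y p \<mu> H D" by (metis IntD1 IntD2)
  define C where "C = ray_const D p"
  \<comment> \<open>\<open>median_const\<close> converts the distance into a Gromov product,
    \<open>C + 4 * \<delta>\<close> is the loss on the way to infinity, and 1 restores
    strictness.\<close>
  obtain M where M: "\<And>x t. x \<in> mspace Y \<Longrightarrow> 0 \<le> t \<Longrightarrow>
     mdist X (\<pi> p) (\<pi> (\<mu> p x (h t))) \<le> R + 1 + C + 4 * \<delta> + median_const \<Longrightarrow> mdist Y p (\<mu> p x (h t)) \<le> M"
    using median_bounded[OF h(2)] by blast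
  have "liminf (\<lambda>n. median_overlap Y p \<mu> (k n) h) = \<infinity>"
    using conv h k unfolding median_converges_def by auto
  then have "ereal M < liminf (\<lambda>n. median_overlap Y p \<mu> (k n) h)" by simp
  then have "\<forall>\<^sub>F n in sequentially. ereal M < median_overlap Y p \<mu> (k n) h"
    by (rule less_LiminfD)
  then show ?thesis
  proof eventually_elim
    case (elim n)
    then obtain s t where st: "0 \<le> s" "0 \<le> t" "M < mdist Y p (\<mu> p (k n s) (h t))"
      unfolding median_overlap_def less_SUP_iff by auto
    have Y: "k n s \<in> mspace Y" "h t \<in> mspace Y"
      using h(2) k(2)[of n] st median_ray_in by (auto simp: good_rays_def)
    have "R + 1 + C + 4 * \<delta> + median_const < mdist X (\<pi> p) (\<pi> (\<mu> p (k n s) (h t)))"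
      using M[OF Y(1) st(2)] st(3) by linarith
    then have "R + 1 + C + 4 * \<delta> < GP (\<pi> (h t)) (\<pi> (k n s))"
      using GP_median[OF Y] GP_commute[of "\<pi> (h t)" "\<pi> (k n s)"] by linarith
    moreover have "defines_boundary_point X b 0 (\<lambda>t. \<pi> (h t)) (boundary_projection \<mu> Y H b \<xi>)"
      by (rule good_ray_defines[OF sub \<xi> h])
    moreover have "defines_boundary_point X b 0 (\<lambda>t. \<pi> (k n t)) (boundary_projection \<mu> Y H b (\<Xi> n))"
      using \<Xi> k by (intro good_ray_defines[OF sub]) auto
    ultimately have "ereal (R + 1) \<le>
        boundary_product X b (boundary_projection \<mu> Y H b \<xi>) (boundary_projection \<mu> Y H b (\<Xi> n))"
      using good_ray_coarse_ray[OF h(2)] good_ray_coarse_ray[OF k(2)[of n]] st(1,2) unfolding C_def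
      by (intro GP_imp_boundary_product[where s = t and t = s]) auto
    then show ?case by (rule less_le_trans[rotated]) simp
  qed
qed

text \<open>The growth rate \<open>n\<close> is the one supplied by a sequence whose
  \<open>n\<close>-th member is chosen in the ball of radius \<open>n\<close>.\<close>

lemma boundary_product_imp_median_converges:
  assumes sub: "sublinear_fun \<kappa>" and \<xi>: "\<xi> \<in> kappa_boundary Y p \<kappa>" and \<Xi>: "range \<Xi> \<subseteq> kappa_boundary Y p \<kappa>"
    and far: "\<And>n. ereal (real n) <
           boundary_product X b (boundary_projection \<mu> Y H b \<xi>) (boundary_projection \<mu> Y H b (\<Xi> n))"
  shows "median_converges Y p \<mu> H D \<Xi> \<xi>"
  unfolding median_converges_def
proof (intro allI impI)
  fix k h assume "(\<forall>n. k n \<in> \<Xi> n \<inter> good_rays Y p \<mu> H D) \<and> h \<in> \<xi> \<inter> good_rays Y p \<mu> H D"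
  then have h: "h \<in> \<xi>" "h \<in> good_rays Y p \<mu> H D"
    and k: "\<And>n. k n \<in> \<Xi> n" "\<And>n. k n \<in> good_rays Y p \<mu> H D" by auto
  \<comment> \<open>This is the Lipschitz bound for \<open>\<pi>\<close> solved for the distance in
    the group; \<open>c + 1\<close> replaces \<open>c\<close>, which may be 0.\<close>
  have large: "ereal ((real n - median_const - c) / (c + 1)) \<le> median_overlap Y p \<mu> (k n) h" for n
  proof -
    have "defines_boundary_point X b 0 (\<lambda>t. \<pi> (h t)) (boundary_projection \<mu> Y H b \<xi>)"
      by (rule good_ray_defines[OF sub \<xi> h])
    moreover have "defines_boundary_point X b 0 (\<lambda>t. \<pi> (k n t)) (boundary_projection \<mu> Y H b (\<Xi> n))"
      using \<Xi> k by (intro good_ray_defines[OF sub]) auto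
    ultimately obtain t s where st: "0 \<le> t" "0 \<le> s" "real n < GP (\<pi> (h t)) (\<pi> (k n s))"
      using boundary_product_imp_GP far by blast
    have Y: "k n s \<in> mspace Y" "h t \<in> mspace Y"
      using h(2) k(2)[of n] st median_ray_in by (auto simp: good_rays_def)
    let ?m = "\<mu> p (k n s) (h t)"
    have "real n - median_const \<le> mdist X (\<pi> p) (\<pi> ?m)"
      using GP_median[OF Y] GP_commute[of "\<pi> (h t)" "\<pi> (k n s)"] st(3) by linarith
    also have "\<dots> \<le> c * mdist Y p ?m + c"
      using q_Lipschitz[OF top_in p_in] mu_in p_in Y by blast
    also have "\<dots> \<le> (c + 1) * mdist Y p ?m + c" by (simp add: algebra_simps)
    finally have "(real n - median_const - c) / (c + 1) \<le> mdist Y p ?m"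
      using c_nonneg by (simp add: field_simps)
    then show ?thesis
      unfolding median_overlap_def using st(1,2) by (intro SUP_upper2[of "(s, t)"]) auto
  qed
  show "liminf (\<lambda>n. median_overlap Y p \<mu> (k n) h) = \<infinity>"
  proof (rule ereal_top)
    fix B
    have "\<forall>\<^sub>F n in sequentially. B * (c + 1) + median_const + c \<le> real n"
      using filterlim_real_sequentially by (auto simp: filterlim_at_top)
    then have "\<forall>\<^sub>F n in sequentially. ereal B \<le> median_overlap Y p \<mu> (k n) h"
    proof eventually_elim
      case (elim n)
      then have "B \<le> (real n - median_const - c) / (c + 1)" using c_nonneg by (simp add: field_simps)
      then have "ereal B \<le> ereal ((real n - median_const - c) / (c + 1))" by simp
      then show ?case using large[of n] by (rule order_trans)
    qed
    then show "ereal B \<le> liminf (\<lambda>n. median_overlap Y p \<mu> (k n) h)" by (rule Liminf_bounded)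
  qed
qed

theorem median_topology_eq_projection_topology:
  assumes sub: "sublinear_fun \<kappa>" and reps: "\<And>\<xi>. \<xi> \<in> kappa_boundary Y p \<kappa> \<Longrightarrow> \<xi> \<inter> good_rays Y p \<mu> H D \<noteq> {}"
  shows "median_topology Y p \<kappa> \<mu> H D = projection_topology Y p \<kappa> \<mu> H b"
proof -
  let ?B = "kappa_boundary Y p \<kappa>" and ?\<pi> = "boundary_projection \<mu> Y H b"
  let ?prod = "boundary_product X b"
  have bd: "?\<pi> \<xi> \<in> gromov_boundary X b" if "\<xi> \<in> ?B" for \<xi>
    using good_ray_defines[OF sub that] reps[OF that] unfolding defines_boundary_point_def by blast
  have "openin (median_topology Y p \<kappa> \<mu> H D) U \<longleftrightarrow> openin (projection_topology Y p \<kappa> \<mu> H b) U" for U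
  proof
    assume "openin (projection_topology Y p \<kappa> \<mu> H b) U"
    then obtain V where V: "openin (visual_topology X b) V" "U = ?\<pi> -` V \<inter> ?B"
      unfolding projection_topology_def openin_pullback_topology by auto
    show "openin (median_topology Y p \<kappa> \<mu> H D) U"
      unfolding openin_median_topology
    proof (intro conjI ballI allI impI)
      show "U \<subseteq> ?B" using V by auto
      fix \<xi> \<Xi> assume \<xi>: "\<xi> \<in> U" and \<Xi>: "range \<Xi> \<subseteq> ?B \<and> median_converges Y p \<mu> H D \<Xi> \<xi>"
      obtain R where R: "{\<eta> \<in> gromov_boundary X b. ereal R < ?prod (?\<pi> \<xi>) \<eta>} \<subseteq> V"
        using V \<xi> unfolding openin_visual_topology by blast
      have "\<forall>\<^sub>F n in sequentially. ereal R < ?prod (?\<pi> \<xi>) (?\<pi> (\<Xi> n))"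
        using median_converges_imp_boundary_product[OF sub reps] \<xi> \<Xi> V(2) by blast
      then show "\<forall>\<^sub>F n in sequentially. \<Xi> n \<in> U"
      proof eventually_elim
        case (elim n)
        have "\<Xi> n \<in> ?B" using \<Xi> by auto
        with elim bd R V(2) show ?case by blast
      qed
    qed
  next
    assume U: "openin (median_topology Y p \<kappa> \<mu> H D) U"
    \<comment> \<open>The open set must also contain balls around boundary points outside the image
      of \<open>?\<pi>\<close>. Hence it collects every \<open>\<zeta>\<close> some ball of which
      pulls back into \<open>U\<close>.\<close>
    define V where "V = {\<zeta> \<in> gromov_boundary X b.
        \<exists>R. \<forall>\<eta>\<in>?B. ereal R < ?prod \<zeta> (?\<pi> \<eta>) \<longrightarrow> \<eta> \<in> U}"
    have "openin (visual_topology X b) V"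
      unfolding openin_visual_topology
    proof (intro conjI ballI)
      show "V \<subseteq> gromov_boundary X b" by (auto simp: V_def)
      fix \<zeta> assume "\<zeta> \<in> V"
      then obtain R where \<zeta>: "\<zeta> \<in> gromov_boundary X b"
        and R: "\<And>\<eta>. \<eta> \<in> ?B \<Longrightarrow> ereal R < ?prod \<zeta> (?\<pi> \<eta>) \<Longrightarrow> \<eta> \<in> U" by (auto simp: V_def)
      show "\<exists>R'. {\<eta> \<in> gromov_boundary X b. ereal R' < ?prod \<zeta> \<eta>} \<subseteq> V"
      proof (intro exI subsetI)
        fix \<zeta>' assume \<zeta>': "\<zeta>' \<in> {\<eta> \<in> gromov_boundary X b. ereal (R + \<delta> + 1) < ?prod \<zeta> \<eta>}"
        have "\<eta> \<in> U" if "\<eta> \<in> ?B" "ereal (R + \<delta> + 1) < ?prod \<zeta>' (?\<pi> \<eta>)" for \<eta>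
          using \<zeta>' that by (intro R boundary_product_ultra[OF \<zeta> _ bd]) auto
        then show "\<zeta>' \<in> V" using \<zeta>' unfolding V_def by blast
      qed
    qed
    moreover have "U = ?\<pi> -` V \<inter> ?B"
    proof (intro equalityI subsetI)
      fix \<xi> assume \<xi>: "\<xi> \<in> U"
      then have \<xi>B: "\<xi> \<in> ?B" using U by (auto simp: openin_median_topology)
      have "\<exists>R. \<forall>\<eta>\<in>?B. ereal R < ?prod (?\<pi> \<xi>) (?\<pi> \<eta>) \<longrightarrow> \<eta> \<in> U"
      proof (rule ccontr)
        assume "\<nexists>R. \<forall>\<eta>\<in>?B. ereal R < ?prod (?\<pi> \<xi>) (?\<pi> \<eta>) \<longrightarrow> \<eta> \<in> U"
        \<comment> \<open>Taking radius \<open>n\<close> for each \<open>n\<close> gives a sequence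
          that converges to \<open>\<xi>\<close> in the median sense but avoids the median-open
          \<open>U\<close>.\<close>
        then have "\<forall>n::nat. \<exists>\<eta>. \<eta> \<in> ?B \<and> ereal (real n) < ?prod (?\<pi> \<xi>) (?\<pi> \<eta>) \<and> \<eta> \<notin> U" by blast
        then obtain \<Xi> where \<Xi>: "\<And>n. \<Xi> n \<in> ?B" "\<And>n. ereal (real n) < ?prod (?\<pi> \<xi>) (?\<pi> (\<Xi> n))"
          "\<And>n. \<Xi> n \<notin> U" by metis
        then have "median_converges Y p \<mu> H D \<Xi> \<xi>"
          by (intro boundary_product_imp_median_converges[OF sub \<xi>B]) auto
        then have "\<forall>\<^sub>F n in sequentially. \<Xi> n \<in> U"
          using U \<xi> \<Xi>(1) unfolding openin_median_topology by blast
        with \<Xi>(3) show False by simp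
      qed
      with bd[OF \<xi>B] \<xi>B show "\<xi> \<in> ?\<pi> -` V \<inter> ?B" by (simp add: V_def)
    next
      fix \<xi> assume "\<xi> \<in> ?\<pi> -` V \<inter> ?B"
      then show "\<xi> \<in> U" using boundary_product_self[OF bd] unfolding V_def by blast
    qed
    ultimately show "openin (projection_topology Y p \<kappa> \<mu> H b) U"
      unfolding projection_topology_def openin_pullback_topology by blast
  qed
  then show ?thesis by (simp add: topology_eq)
qed

end


section \<open>Hierarchically hyperbolic spaces\<close>

text \<open>A unique maximal element of an infinite order need not be a greatest one. Finite
  complexity helps: a largest chain above \<open>V\<close> ends in a maximal element.\<close>

lemma htop_maximum:
  assumes nest: "hhs_nesting H \<xi>\<^sub>0" and compl: "hhs_complexity H n"
  shows "htop H \<in> hindex H" "\<And>V. V \<in> hindex H \<Longrightarrow> hnest H V (htop H)"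
proof -
  have ex1: "\<exists>!S. hmaximal H S" using nest by (simp add: hhs_nesting_def)
  then have top: "hmaximal H (htop H)" unfolding htop_def by (rule theI')
  then show "htop H \<in> hindex H" by (simp add: hmaximal_def)
  have refl: "hnest H V V" if "V \<in> hindex H" for V
    using nest that by (auto simp: hhs_nesting_def reflp_on_def)
  have tr: "hnest H U W" if "hnest H U V" "hnest H V W" "U \<in> hindex H" "V \<in> hindex H" "W \<in> hindex H" for U V W
    using nest that unfolding hhs_nesting_def by (meson transp_onD)
  have anti: "V = W" if "hnest H V W" "hnest H W V" "V \<in> hindex H" "W \<in> hindex H" for V W
    using nest that unfolding hhs_nesting_def by (meson antisymp_onD)
  fix V assume V: "V \<in> hindex H"
  \<comment> \<open>Each chain comes with its greatest element, to which a strictly larger one could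
    be added.\<close>
  define chain where "chain F \<longleftrightarrow> F \<subseteq> hindex H \<and> (\<forall>U\<in>F. \<forall>W\<in>F. hnest H U W \<or> hnest H W U) \<and>
      (\<exists>W\<in>F. hnest H V W \<and> (\<forall>U\<in>F. hnest H U W))" for F
  have fin: "finite F \<and> card F \<le> n" if "chain F" for F
    using compl that unfolding hhs_complexity_def chain_def by blast
  have "chain {V}" using V refl by (auto simp: chain_def)
  moreover have "\<forall>F. chain F \<longrightarrow> card F < Suc n" using fin by (simp add: less_Suc_eq_le)
  ultimately obtain F where F: "chain F" "\<And>F'. chain F' \<Longrightarrow> card F' \<le> card F"
    using ex_has_greatest_nat[of chain "{V}" card "Suc n"] by blast
  then obtain W where W: "W \<in> F" "hnest H V W" "\<And>U. U \<in> F \<Longrightarrow> hnest H U W" and sub: "F \<subseteq> hindex H"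
    by (auto simp: chain_def)
  have "hmaximal H W"
    unfolding hmaximal_def
  proof (intro conjI ballI impI)
    show W': "W \<in> hindex H" using W(1) sub by auto
    fix Z assume Z: "Z \<in> hindex H" "hnest H W Z"
    have le: "hnest H U Z" if "U \<in> insert Z F" for U
    proof (cases "U = Z")
      case False
      with that have "U \<in> F" by simp
      then show ?thesis using tr[OF W(3) Z(2)] W' Z(1) sub by blast
    qed (use refl Z in simp)
    have "hnest H V Z" using tr[OF W(2) Z(2)] V W' Z(1) by blast
    then have "chain (insert Z F)"
      using F(1) Z(1) le unfolding chain_def by blast
    then have "card (insert Z F) \<le> card F" by (rule F(2))
    then have "Z \<in> F" using fin[OF F(1)] by (simp add: card_insert_if split: if_splits)
    then show "Z = W" using anti[OF W(3) Z(2)] Z(1) W' by blast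
  qed
  with ex1 top have "W = htop H" by blast
  with W(2) show "hnest H V (htop H)" by simp
qed

text \<open>If a geodesic from \<open>a\<close> to \<open>b\<close> stayed far from
  \<open>r\<close>, its image in \<open>\<C>(V)\<close> would have diameter at most
  \<open>E\<close>. Consistency at both ends puts \<open>a'\<close> and \<open>b'\<close> within
  \<open>\<kappa>\<^sub>0\<close> of this image, so they would not be far apart.\<close>

lemma hhs_passes_by:
  assumes proj: "hhs_projections Y H \<delta> \<xi>\<^sub>0 K" and nest: "hhs_nesting H \<xi>\<^sub>0"
    and cons: "hhs_consistency Y H \<xi>\<^sub>0 \<kappa>\<^sub>0" and bgi: "hhs_bounded_geodesic_image H E"
    and pos: "0 \<le> \<xi>\<^sub>0" "0 \<le> \<kappa>\<^sub>0" "0 \<le> E"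
    and V: "V \<in> hindex H" "W \<in> hindex H" "hpnest H V W" and xy: "x \<in> mspace Y" "y \<in> mspace Y"
    and a: "a \<in> hproj H W x" "a' \<in> hproj H V x" and b: "b \<in> hproj H W y" "b' \<in> hproj H V y"
    and r: "r \<in> hrho H V W" and far: "E + 2 * \<kappa>\<^sub>0 < mdist (hspace H V) a' b'"
  shows "coarsely_between (hspace H W) (2 * (E + \<kappa>\<^sub>0 + 2 * \<xi>\<^sub>0 + 1)) a r b"
proof (rule ccontr)
  assume not: "\<not> ?thesis"
  \<comment> \<open>\<open>E\<close> excludes the second alternative of bounded geodesic image and
    \<open>\<kappa>\<^sub>0\<close> the first one of consistency. One \<open>\<xi>\<^sub>0\<close>
    allows for moving inside \<open>hrho H V W\<close>, the other inside a projection; 1 is for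
    unattained infima.\<close>
  let ?X = "hspace H W" and ?L = "E + \<kappa>\<^sub>0 + 2 * \<xi>\<^sub>0 + 1"
  have hp: "hproj H U z \<subseteq> mspace (hspace H U)" "hproj H U z \<noteq> {}"
      "\<And>u v. u \<in> hproj H U z \<Longrightarrow> v \<in> hproj H U z \<Longrightarrow> mdist (hspace H U) u v \<le> \<xi>\<^sub>0"
    if "U \<in> hindex H" "z \<in> mspace Y" for U z
    using proj that unfolding hhs_projections_def mdiam_le_iff by blast+
  have rho: "hrho H V W \<subseteq> mspace ?X" "\<And>u v. u \<in> hrho H V W \<Longrightarrow> v \<in> hrho H V W \<Longrightarrow> mdist ?X u v \<le> \<xi>\<^sub>0"
    and rho_map: "\<And>z. z \<in> mspace ?X \<Longrightarrow> hrho_map H W V z \<subseteq> mspace (hspace H V) \<and> hrho_map H W V z \<noteq> {}"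
    using nest V unfolding hhs_nesting_def mdiam_le_iff by blast+
  have X: "a \<in> mspace ?X" "b \<in> mspace ?X" using hp(1) V a b xy by blast+
  then obtain P where P: "is_geodesic ?X P a b"
    using proj V unfolding hhs_projections_def geodesic_space_def by blast
  note ends = is_geodesic_endpoints[OF P]
  have away: "?L - \<xi>\<^sub>0 \<le> mdist ?X z v" if "z \<in> P" "v \<in> hrho H V W" for z v
  proof -
    have "\<not> set_dist ?X {r} P < ?L"
      using coarsely_between_near_geodesic[OF P] not r rho by blast
    then have "?L \<le> mdist ?X r z" using set_dist_le[of r "{r}" z P ?X] that by simp
    moreover have "mdist ?X r z \<le> mdist ?X r v + mdist ?X v z"
      using that r rho(1) ends(3) by (intro mdist_triangle) auto
    ultimately show ?thesis using rho(2)[OF r that(2)] by (simp add: mdist_commute)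
  qed
  have "\<not> set_dist ?X {z} (hrho H V W) \<le> E" if "z \<in> P" for z
  proof
    assume "set_dist ?X {z} (hrho H V W) \<le> E"
    then have "set_dist ?X {z} (hrho H V W) < ?L - \<xi>\<^sub>0" using pos by linarith
    then obtain v where "v \<in> hrho H V W" "mdist ?X z v < ?L - \<xi>\<^sub>0"
      by (rule set_dist_less_imp) (use r in auto)
    with away[OF that] show False by fastforce
  qed
  then have "mdiam (hspace H V) (\<Union>(hrho_map H W V ` P)) \<le> ereal E"
    using bgi V P unfolding hhs_bounded_geodesic_image_def by blast
  then have image: "mdist (hspace H V) u v \<le> E" if "u \<in> hrho_map H W V a" "v \<in> hrho_map H W V b" for u v
    using that ends(1,2) unfolding mdiam_le_iff by blast
  have near: "mdist (hspace H V) w' u \<le> \<kappa>\<^sub>0"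
    if z: "z \<in> mspace Y" "w \<in> P" "w \<in> hproj H W z" "w' \<in> hproj H V z" and u: "u \<in> hrho_map H W V w" for z w w' u
  proof -
    have "\<not> set_dist ?X (hproj H W z) (hrho H V W) \<le> \<kappa>\<^sub>0"
    proof
      assume "set_dist ?X (hproj H W z) (hrho H V W) \<le> \<kappa>\<^sub>0"
      then have "set_dist ?X (hproj H W z) (hrho H V W) < ?L - 2 * \<xi>\<^sub>0" using pos by linarith
      then obtain w1 v where w1: "w1 \<in> hproj H W z" "v \<in> hrho H V W" "mdist ?X w1 v < ?L - 2 * \<xi>\<^sub>0"
        by (rule set_dist_less_imp) (use z r in auto)
      have "mdist ?X w v \<le> mdist ?X w w1 + mdist ?X w1 v"
        using w1 rho(1) hp(1)[OF V(2) z(1)] z(3) by (intro mdist_triangle) auto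
      with away[OF z(2) w1(2)] hp(3)[OF V(2) z(1) z(3) w1(1)] w1(3) show False by linarith
    qed
    moreover have "min (ereal (set_dist ?X (hproj H W z) (hrho H V W)))
        (mdiam (hspace H V) (hproj H V z \<union> \<Union>(hrho_map H W V ` hproj H W z))) \<le> ereal \<kappa>\<^sub>0"
      using cons V z(1) unfolding hhs_consistency_def by blast
    ultimately have "mdiam (hspace H V) (hproj H V z \<union> \<Union>(hrho_map H W V ` hproj H W z)) \<le> ereal \<kappa>\<^sub>0"
      by (simp add: min_le_iff_disj)
    then show ?thesis using z u unfolding mdiam_le_iff by blast
  qed
  obtain u v where uv: "u \<in> hrho_map H W V a" "v \<in> hrho_map H W V b" using rho_map X by blast
  have VX: "a' \<in> mspace (hspace H V)" "b' \<in> mspace (hspace H V)" "u \<in> mspace (hspace H V)" "v \<in> mspace (hspace H V)"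
    using hp(1)[OF V(1)] xy a b uv rho_map X by blast+
  have "mdist (hspace H V) a' u \<le> \<kappa>\<^sub>0" "mdist (hspace H V) b' v \<le> \<kappa>\<^sub>0"
    using near[OF xy(1) ends(1) a uv(1)] near[OF xy(2) ends(2) b uv(2)] by auto
  with image[OF uv] far mdist_triangle[OF VX(1,3,2)] mdist_triangle[OF VX(3,4,2)]
  show False by (simp add: mdist_commute)
qed

lemma median_projections_exist:
  assumes hhs: "hierarchically_hyperbolic_space Y H" and cm: "coarse_median Y \<mu>"
    and hm: "hierarchical_median Y H \<mu>" and p: "p \<in> mspace Y" and b: "b \<in> mspace (hspace H (htop H))"
  obtains \<delta> q \<rho> c \<theta> where "median_projections H \<delta> b Y \<mu> p q \<rho> c \<theta>"
proof -
  from hhs obtain \<delta> \<xi>\<^sub>0 K \<kappa>\<^sub>0 n E where pos: "0 \<le> \<xi>\<^sub>0" "0 \<le> K" "0 \<le> \<kappa>\<^sub>0" "0 \<le> E"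
    and proj: "hhs_projections Y H \<delta> \<xi>\<^sub>0 K" and nest: "hhs_nesting H \<xi>\<^sub>0"
    and cons: "hhs_consistency Y H \<xi>\<^sub>0 \<kappa>\<^sub>0" and compl: "hhs_complexity H n"
    and bgi: "hhs_bounded_geodesic_image H E" and uniq: "hhs_uniqueness Y H"
    unfolding hierarchically_hyperbolic_space_def by blast
  from uniq obtain \<theta> where \<theta>: "\<And>k x y. 0 \<le> k \<Longrightarrow> x \<in> mspace Y \<Longrightarrow> y \<in> mspace Y \<Longrightarrow>
      \<theta> k \<le> mdist Y x y \<Longrightarrow> \<exists>V\<in>hindex H. k \<le> hdist H V x y"
    unfolding hhs_uniqueness_def by blast
  have mu: "\<mu> x y z \<in> mspace Y" "\<mu> x x y = x" "\<mu> x y z = \<mu> y x z \<and> \<mu> x y z = \<mu> x z y"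
    if "x \<in> mspace Y" "y \<in> mspace Y" "z \<in> mspace Y" for x y z
    using cm that unfolding coarse_median_def by blast+
  from cm obtain C where
    "\<forall>x\<in>mspace Y. \<forall>y\<in>mspace Y. \<forall>z\<in>mspace Y. \<forall>x'\<in>mspace Y.
        mdist Y (\<mu> (\<mu> x x' y) x' z) (\<mu> x x' (\<mu> y x' z)) \<le> C \<and>
        mdist Y (\<mu> x y z) (\<mu> x' y z) \<le> C * mdist Y x x' + C"
    unfolding coarse_median_def by (elim conjE exE)
  then have mu_Lip: "mdist Y (\<mu> x y z) (\<mu> x' y z) \<le> C * mdist Y x x' + C"
    if "x \<in> mspace Y" "x' \<in> mspace Y" "y \<in> mspace Y" "z \<in> mspace Y" for x x' y z
    using that by simp
  \<comment> \<open>Only the side from \<open>x\<close> to \<open>y\<close> is kept; the symmetry of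
    \<open>\<mu>\<close> yields the other two in \<open>mu_between_13\<close> and
    \<open>mu_between_23\<close>.\<close>
  from hm obtain r where r: "\<And>x y z W. x \<in> mspace Y \<Longrightarrow> y \<in> mspace Y \<Longrightarrow> z \<in> mspace Y \<Longrightarrow> W \<in> hindex H \<Longrightarrow>
      \<exists>u\<in>hproj H W x. \<exists>v\<in>hproj H W y. \<exists>P. \<exists>w\<in>mspace (hspace H W). is_geodesic (hspace H W) P u v \<and>
        set_dist (hspace H W) {w} P \<le> r \<and> set_dist (hspace H W) (hproj H W (\<mu> x y z)) {w} \<le> r"
    unfolding hierarchical_median_def by metis
  define q where "q W x = (SOME a. a \<in> hproj H W x)" for W x
  define \<rho> where "\<rho> V = (SOME a. a \<in> hrho H V (htop H))" for V
  \<comment> \<open>The summands serve, in this order, the Lipschitz bound for the selected points,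
    the Lipschitz bound for \<open>\<mu>\<close>, \<open>mu_between\<close> and
    \<open>passes_by\<close>. The signs of \<open>C\<close> and \<open>r\<close> are
    unknown.\<close>
  define c where "c = (K + 1 + 2 * \<xi>\<^sub>0) + \<bar>C\<bar> + (2 * (\<bar>r\<bar> + 1) + 6 * (\<xi>\<^sub>0 + \<bar>r\<bar> + 1)) +
      2 * (E + \<kappa>\<^sub>0 + 2 * \<xi>\<^sub>0 + 1)"
  have c: "0 \<le> c" "\<xi>\<^sub>0 \<le> c" "K + 1 + 2 * \<xi>\<^sub>0 \<le> c" "C \<le> c" "2 * (\<bar>r\<bar> + 1) + 6 * (\<xi>\<^sub>0 + \<bar>r\<bar> + 1) \<le> c"
    "2 * (E + \<kappa>\<^sub>0 + 2 * \<xi>\<^sub>0 + 1) \<le> c" "E + 2 * \<kappa>\<^sub>0 \<le> c"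
    using pos by (auto simp: c_def)
  note top = htop_maximum[OF nest compl]
  have hp: "hproj H U z \<subseteq> mspace (hspace H U)" "hproj H U z \<noteq> {}"
      "\<And>u v. u \<in> hproj H U z \<Longrightarrow> v \<in> hproj H U z \<Longrightarrow> mdist (hspace H U) u v \<le> \<xi>\<^sub>0"
    if "U \<in> hindex H" "z \<in> mspace Y" for U z
    using proj that unfolding hhs_projections_def mdiam_le_iff by blast+
  have q: "q W x \<in> hproj H W x" "q W x \<in> mspace (hspace H W)"
    if "W \<in> hindex H" "x \<in> mspace Y" for W x
    using hp(1,2)[OF that] unfolding q_def by (auto intro: someI)
  have pnest: "hpnest H V (htop H)" if "V \<in> hindex H" "V \<noteq> htop H" for V
    using top(2) that by (simp add: hpnest_def)
  have \<rho>: "\<rho> V \<in> hrho H V (htop H)" "\<rho> V \<in> mspace (hspace H (htop H))" if "V \<in> hindex H" "V \<noteq> htop H" for V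
  proof -
    have "hrho H V (htop H) \<noteq> {}" "hrho H V (htop H) \<subseteq> mspace (hspace H (htop H))"
      using nest pnest[OF that] that(1) top(1) unfolding hhs_nesting_def by blast+
    then show "\<rho> V \<in> hrho H V (htop H)" "\<rho> V \<in> mspace (hspace H (htop H))"
      unfolding \<rho>_def by (auto intro: someI)
  qed
  have affine: "k * d + k \<le> c * d + c" if "k \<le> c" "0 \<le> d" for k d
    using that by (intro add_mono mult_right_mono) auto
  \<comment> \<open>The uniqueness axiom provides a domain with distance at least its parameter. The
    shift by 1 makes this contradict the bound \<open>k\<close>, and the maximum keeps the parameter
    nonnegative.\<close>
  have "median_projections H \<delta> b Y \<mu> p q \<rho> c (\<lambda>k. \<theta> (max (k + 1) 0))"
  proof
    show "hyperbolic \<delta> (hspace H (htop H))" using proj top(1) by (simp add: hhs_projections_def)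
    show "b \<in> mspace (hspace H (htop H))" "0 \<le> c" "p \<in> mspace Y" "htop H \<in> hindex H" by fact+
    show "q W x \<in> mspace (hspace H W)" if "W \<in> hindex H" "x \<in> mspace Y" for W x using q that by simp
    show "q (htop H) x \<in> hproj H (htop H) x" if "x \<in> mspace Y" for x using q top that by simp
    show "a \<in> mspace (hspace H (htop H)) \<and> mdist (hspace H (htop H)) (q (htop H) x) a \<le> c"
      if "x \<in> mspace Y" "a \<in> hproj H (htop H) x" for x a
      using hp(1)[OF top(1) that(1)] hp(3)[OF top(1) that(1) q(1)[OF top(1) that(1)] that(2)] that(2) c(2)
      by auto
    show "mdist (hspace H W) (q W x) (q W y) \<le> c * mdist Y x y + c"
      if W: "W \<in> hindex H" and xy: "x \<in> mspace Y" "y \<in> mspace Y" for W x y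
    proof -
      let ?d = "mdist Y x y"
      have "hdist H W x y \<le> K * ?d + K" using proj W xy by (auto simp: hhs_projections_def)
      then have "set_dist (hspace H W) (hproj H W x) (hproj H W y) < K * ?d + K + 1"
        unfolding hdist_def by simp
      then obtain u v where uv: "u \<in> hproj H W x" "v \<in> hproj H W y" "mdist (hspace H W) u v < K * ?d + K + 1"
        by (rule set_dist_less_imp) (use hp(2)[OF W] xy in auto)
      have X: "u \<in> mspace (hspace H W)" "v \<in> mspace (hspace H W)" using uv hp(1)[OF W] xy by blast+
      have "mdist (hspace H W) (q W x) (q W y) \<le> K * ?d + (K + 1 + 2 * \<xi>\<^sub>0)"
        using mdist_triangle[OF q(2)[OF W xy(1)] X(1) q(2)[OF W xy(2)]]
          mdist_triangle[OF X q(2)[OF W xy(2)]] uv(3)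
          hp(3)[OF W xy(1) q(1)[OF W xy(1)] uv(1)] hp(3)[OF W xy(2) uv(2) q(1)[OF W xy(2)]]
        by linarith
      also have "\<dots> \<le> c * ?d + c" using c pos by (intro add_mono mult_right_mono) auto
      finally show ?thesis .
    qed
    show "\<mu> x y z \<in> mspace Y" if "x \<in> mspace Y" "y \<in> mspace Y" "z \<in> mspace Y" for x y z
      using mu(1) that .
    show "\<mu> x x y = x" if "x \<in> mspace Y" "y \<in> mspace Y" for x y
      using mu(2) that by blast
    show "\<mu> x y z = \<mu> y x z \<and> \<mu> x y z = \<mu> x z y"
      if "x \<in> mspace Y" "y \<in> mspace Y" "z \<in> mspace Y" for x y z
      using mu(3) that .
    show "mdist Y (\<mu> x y z) (\<mu> x' y z) \<le> c * mdist Y x x' + c"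
      if "x \<in> mspace Y" "x' \<in> mspace Y" "y \<in> mspace Y" "z \<in> mspace Y" for x x' y z
      using mu_Lip[OF that] affine[OF c(4), of "mdist Y x x'"] by simp
    show "coarsely_between (hspace H W) c (q W x) (q W (\<mu> x y z)) (q W y)"
      if W: "W \<in> hindex H" and xyz: "x \<in> mspace Y" "y \<in> mspace Y" "z \<in> mspace Y" for W x y z
    proof -
      let ?X = "hspace H W" and ?m = "\<mu> x y z"
      obtain u v P w where uv: "u \<in> hproj H W x" "v \<in> hproj H W y" and w: "w \<in> mspace ?X"
        and P: "is_geodesic ?X P u v" "set_dist ?X {w} P \<le> r" "set_dist ?X (hproj H W ?m) {w} \<le> r"
        using r[OF xyz W] by blast
      have m: "?m \<in> mspace Y" using mu(1) xyz .
      have side: "set_dist ?X {w} P < \<bar>r\<bar> + 1" using P by linarith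
      have "set_dist ?X (hproj H W ?m) {w} < \<bar>r\<bar> + 1" using P by linarith
      then obtain m' where m': "m' \<in> hproj H W ?m" "mdist ?X m' w < \<bar>r\<bar> + 1"
        by (rule set_dist_less_imp) (use hp(2)[OF W m] in auto)
      have X: "u \<in> mspace ?X" "v \<in> mspace ?X" "m' \<in> mspace ?X" using uv m' hp(1)[OF W] xyz m by blast+
      have "mdist ?X w (q W ?m) \<le> \<xi>\<^sub>0 + \<bar>r\<bar> + 1"
        using mdist_triangle[OF w X(3) q(2)[OF W m]] m'(2) mdist_commute[of ?X w m']
          hp(3)[OF W m m'(1) q(1)[OF W m]] by linarith
      moreover have "mdist ?X u (q W x) \<le> \<xi>\<^sub>0 + \<bar>r\<bar> + 1" "mdist ?X v (q W y) \<le> \<xi>\<^sub>0 + \<bar>r\<bar> + 1"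
        using hp(3)[OF W xyz(1) uv(1) q(1)[OF W xyz(1)]] hp(3)[OF W xyz(2) uv(2) q(1)[OF W xyz(2)]]
        by linarith+
      moreover have "coarsely_between ?X (2 * (\<bar>r\<bar> + 1)) u w v"
        by (rule coarsely_between_near_geodesic[OF P(1) w side])
      ultimately have "coarsely_between ?X (2 * (\<bar>r\<bar> + 1) + 6 * (\<xi>\<^sub>0 + \<bar>r\<bar> + 1)) (q W x) (q W ?m) (q W y)"
        using X w q(2)[OF W] xyz m by (intro coarsely_between_perturb[of ?X _ u w v]) auto
      then show ?thesis using c(5) by (rule coarsely_between_mono)
    qed
    show "\<rho> V \<in> mspace (hspace H (htop H))" if "V \<in> hindex H" "V \<noteq> htop H" for V
      using \<rho> that by simp
    show "coarsely_between (hspace H (htop H)) c (q (htop H) x) (\<rho> V) (q (htop H) y)"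
      if V: "V \<in> hindex H" "V \<noteq> htop H" and xy: "x \<in> mspace Y" "y \<in> mspace Y"
        and far: "c < mdist (hspace H V) (q V x) (q V y)" for V x y
    proof -
      have "E + 2 * \<kappa>\<^sub>0 < mdist (hspace H V) (q V x) (q V y)" using far c(7) by linarith
      from hhs_passes_by[OF proj nest cons bgi pos(1,3,4) V(1) top(1) pnest[OF V] xy
          q(1)[OF top(1) xy(1)] q(1)[OF V(1) xy(1)] q(1)[OF top(1) xy(2)] q(1)[OF V(1) xy(2)] \<rho>(1)[OF V] this]
      show ?thesis using c(6) by (rule coarsely_between_mono)
    qed
    show "mdist Y x y \<le> \<theta> (max (k + 1) 0)"
      if xy: "x \<in> mspace Y" "y \<in> mspace Y"
        and k: "\<And>W. W \<in> hindex H \<Longrightarrow> mdist (hspace H W) (q W x) (q W y) \<le> k" for x y k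
    proof (rule ccontr)
      assume "\<not> ?thesis"
      then obtain V where V: "V \<in> hindex H" "max (k + 1) 0 \<le> hdist H V x y"
        using \<theta>[of "max (k + 1) 0" x y] xy by auto
      have "hdist H V x y \<le> mdist (hspace H V) (q V x) (q V y)"
        unfolding hdist_def using q(1)[OF V(1)] xy by (intro set_dist_le) auto
      with V(2) k[OF V(1)] show False by linarith
    qed
  qed
  then show thesis by (rule that)
qed

theorem theorem4:
  fixes G :: "('g, 'm) monoid_scheme"
    and A :: "'g set"
    and H :: "('g, 'i, 'x) hhg"
    and \<mu> :: "'g \<Rightarrow> 'g \<Rightarrow> 'g \<Rightarrow> 'g"
    and \<kappa> :: "real \<Rightarrow> real"
    and p :: 'g and b :: 'x and D :: real
  assumes "hierarchically_hyperbolic_group G A H"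
    and "largest_acylindrical_action G (hspace H (htop H)) (top_action H)"
    and "coarse_median (word_metric G A) \<mu>"
    and "hierarchical_median (word_metric G A) H \<mu>"
    and "sublinear_fun \<kappa>"
    and "p \<in> carrier G"
    and "b \<in> mspace (hspace H (htop H))"
    and "\<forall>\<xi>\<in>kappa_boundary (word_metric G A) p \<kappa>. \<xi> \<inter> good_rays (word_metric G A) p \<mu> H D \<noteq> {}"
  shows "homeomorphic_map
           (median_topology (word_metric G A) p \<kappa> \<mu> H D)
           (projection_topology (word_metric G A) p \<kappa> \<mu> H b)
           id"
proof -
  have G: "group G" "A \<subseteq> carrier G" "generate G A = carrier G"
      "hierarchically_hyperbolic_space (word_metric G A) H"
    using assms(1) by (auto simp: hierarchically_hyperbolic_group_def)
  have "p \<in> mspace (word_metric G A)"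
    using group.mspace_word_metric[OF G(1-3)] assms(6) by simp
  from median_projections_exist[OF G(4) assms(3,4) this assms(7)]
  obtain \<delta> q \<rho> c \<theta> where "median_projections H \<delta> b (word_metric G A) \<mu> p q \<rho> c \<theta>" .
  then interpret median_projections H \<delta> b "word_metric G A" \<mu> p q \<rho> c \<theta> .
  show ?thesis
    using median_topology_eq_projection_topology[OF assms(5)] assms(8) by simp
qed

end
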